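(* (In $\mathrm{ZF}$.) $\mathrm{4RC_{fin}}$ implies $\mathrm{RC}_n$ whenever $n$ is an odd natural number greater than $4$.
   Context: The base theory is $\mathrm{ZF}$ (no Axiom of Choice). For a set $x$ and $n\in\omega$, $[x]^n$ is the set of all $n$-element subsets of $x$ and $[x]^{>n}$ is the set of all finite subsets of $x$ with more than $n$ elements. $\mathrm{nRC_{fin}}$: given any infinite set $x$, there exist an infinite subset $y\subseteq x$ and a function $f\colon[y]^{>n}\to[y]^n$ such that $f(z)\subseteq z$ for all $z\in[y]^{>n}$. $\mathrm{RC}_n$: given any infinite set $x$, there exist an infinite subset $y\subseteq x$ and a function $f\colon[y]^n\to y$ such that $f(z)\in z$ for all $z\in[y]^n$. *)

theory Defs
  imports Main
begin

text \<open>
  HOL proves the Axiom of Choice for its own sets, so "in ZF" is rendered as "in every model of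
  first-order ZF": a type \<open>'v\<close> with a binary relation satisfying the axioms of ZF.
  The Separation and Replacement schemes range over first-order formulas with parameters only.
  If they ranged over all HOL predicates, Hilbert's choice operator of HOL would make every model
  satisfy AC.
\<close>

datatype fm = Mem nat nat | Eq nat nat | Neg fm | Conj fm fm | Forall nat fm

primrec sat :: "('v \<Rightarrow> 'v \<Rightarrow> bool) \<Rightarrow> (nat \<Rightarrow> 'v) \<Rightarrow> fm \<Rightarrow> bool" where
  "sat mem e (Mem i j) \<longleftrightarrow> mem (e i) (e j)"
| "sat mem e (Eq i j) \<longleftrightarrow> e i = e j"
| "sat mem e (Neg p) \<longleftrightarrow> \<not> sat mem e p"
| "sat mem e (Conj p q) \<longleftrightarrow> sat mem e p \<and> sat mem e q"
| "sat mem e (Forall i p) \<longleftrightarrow> (\<forall>a. sat mem (e(i := a)) p)"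

text \<open>
  All notions below (natural number, finite, function, \<dots>) are the internal notions of the structure.
  They are written relationally, so that each of them is a first-order formula in \<open>mem\<close>;
  the described object comes first: \<open>is_succ s x\<close> says that \<open>s\<close> is the successor of \<open>x\<close>.
\<close>

locale mem_structure =
  fixes mem :: "'v \<Rightarrow> 'v \<Rightarrow> bool" (infix "\<epsilon>" 50)
begin

definition is_subset :: "'v \<Rightarrow> 'v \<Rightarrow> bool" where
  "is_subset x y \<longleftrightarrow> (\<forall>z. z \<epsilon> x \<longrightarrow> z \<epsilon> y)"

definition is_empty :: "'v \<Rightarrow> bool" where
  "is_empty x \<longleftrightarrow> (\<forall>z. \<not> z \<epsilon> x)"

definition is_upair :: "'v \<Rightarrow> 'v \<Rightarrow> 'v \<Rightarrow> bool" where
  "is_upair p a b \<longleftrightarrow> (\<forall>z. z \<epsilon> p \<longleftrightarrow> z = a \<or> z = b)"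

text \<open>Kuratowski pairs.\<close>

definition is_pair :: "'v \<Rightarrow> 'v \<Rightarrow> 'v \<Rightarrow> bool" where
  "is_pair p a b \<longleftrightarrow> (\<exists>s d. is_upair s a a \<and> is_upair d a b \<and> is_upair p s d)"

definition is_succ :: "'v \<Rightarrow> 'v \<Rightarrow> bool" where
  "is_succ s x \<longleftrightarrow> (\<forall>z. z \<epsilon> s \<longleftrightarrow> z \<epsilon> x \<or> z = x)"

definition is_inductive :: "'v \<Rightarrow> bool" where
  "is_inductive w \<longleftrightarrow>
     (\<exists>z. is_empty z \<and> z \<epsilon> w) \<and> (\<forall>x. x \<epsilon> w \<longrightarrow> (\<exists>s. is_succ s x \<and> s \<epsilon> w))"

text \<open>
  \<open>is_natural n\<close> says that \<open>n\<close> is an element of the model's \<open>\<omega>\<close>, the least inductive set.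
  It need not be one of the numerals \<open>is_numeral k\<close> for \<open>k\<close> a natural number of HOL.
\<close>

definition is_natural :: "'v \<Rightarrow> bool" where
  "is_natural n \<longleftrightarrow> (\<forall>w. is_inductive w \<longrightarrow> n \<epsilon> w)"

definition is_omega :: "'v \<Rightarrow> bool" where
  "is_omega w \<longleftrightarrow> (\<forall>n. n \<epsilon> w \<longleftrightarrow> is_natural n)"

primrec is_numeral :: "nat \<Rightarrow> 'v \<Rightarrow> bool" where
  "is_numeral 0 v \<longleftrightarrow> is_empty v"
| "is_numeral (Suc k) v \<longleftrightarrow> (\<exists>u. is_numeral k u \<and> is_succ v u)"

definition maps_to :: "'v \<Rightarrow> 'v \<Rightarrow> 'v \<Rightarrow> bool" where
  "maps_to f a b \<longleftrightarrow> (\<exists>p. is_pair p a b \<and> p \<epsilon> f)"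

definition is_function :: "'v \<Rightarrow> 'v \<Rightarrow> 'v \<Rightarrow> bool" where
  "is_function f A B \<longleftrightarrow>
     (\<forall>p. p \<epsilon> f \<longrightarrow> (\<exists>a b. a \<epsilon> A \<and> b \<epsilon> B \<and> is_pair p a b)) \<and>
     (\<forall>a. a \<epsilon> A \<longrightarrow> (\<exists>!b. b \<epsilon> B \<and> maps_to f a b))"

definition is_bijection :: "'v \<Rightarrow> 'v \<Rightarrow> 'v \<Rightarrow> bool" where
  "is_bijection f A B \<longleftrightarrow>
     is_function f A B \<and> (\<forall>b. b \<epsilon> B \<longrightarrow> (\<exists>!a. a \<epsilon> A \<and> maps_to f a b))"

definition equinumerous :: "'v \<Rightarrow> 'v \<Rightarrow> bool" where
  "equinumerous A B \<longleftrightarrow> (\<exists>f. is_bijection f A B)"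

definition is_infinite :: "'v \<Rightarrow> bool" where
  "is_infinite x \<longleftrightarrow> \<not> (\<exists>n. is_natural n \<and> equinumerous x n)"

text \<open>
  Addition on \<open>\<omega>\<close>, by recursion on the second argument: \<open>g i = m + i\<close> for \<open>i\<close> in \<open>\<omega>\<close>.
\<close>

definition is_sum :: "'v \<Rightarrow> 'v \<Rightarrow> 'v \<Rightarrow> bool" where
  "is_sum k m n \<longleftrightarrow>
     (\<exists>w g. is_omega w \<and> is_function g w w \<and>
        (\<forall>z. is_empty z \<longrightarrow> maps_to g z m) \<and>
        (\<forall>i j s t. i \<epsilon> w \<and> maps_to g i j \<and> is_succ s i \<and> is_succ t j \<longrightarrow> maps_to g s t) \<and>
        maps_to g n k)"

definition is_odd :: "'v \<Rightarrow> bool" where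
  "is_odd n \<longleftrightarrow> (\<exists>k d. is_natural k \<and> is_sum d k k \<and> is_succ n d)"

text \<open>\<open>[x]\<^sup>n\<close> and \<open>[x]\<^sup>>\<^sup>n\<close>; the order of \<open>\<omega>\<close> is membership.\<close>

definition is_subsets_of_size :: "'v \<Rightarrow> 'v \<Rightarrow> 'v \<Rightarrow> bool" where
  "is_subsets_of_size A x n \<longleftrightarrow> (\<forall>z. z \<epsilon> A \<longleftrightarrow> is_subset z x \<and> equinumerous z n)"

definition is_finite_subsets_above :: "'v \<Rightarrow> 'v \<Rightarrow> 'v \<Rightarrow> bool" where
  "is_finite_subsets_above A x n \<longleftrightarrow>
     (\<forall>z. z \<epsilon> A \<longleftrightarrow> is_subset z x \<and> (\<exists>m. is_natural m \<and> n \<epsilon> m \<and> equinumerous z m))"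

definition nRC_fin :: "'v \<Rightarrow> bool" where
  "nRC_fin n \<longleftrightarrow>
     (\<forall>x. is_infinite x \<longrightarrow>
       (\<exists>y. is_infinite y \<and> is_subset y x \<and>
         (\<exists>A B f. is_finite_subsets_above A y n \<and> is_subsets_of_size B y n \<and>
            is_function f A B \<and>
            (\<forall>z u. z \<epsilon> A \<and> maps_to f z u \<longrightarrow> is_subset u z))))"

definition RC :: "'v \<Rightarrow> bool" where
  "RC n \<longleftrightarrow>
     (\<forall>x. is_infinite x \<longrightarrow>
       (\<exists>y. is_infinite y \<and> is_subset y x \<and>
         (\<exists>A f. is_subsets_of_size A y n \<and> is_function f A y \<and>
            (\<forall>z u. z \<epsilon> A \<and> maps_to f z u \<longrightarrow> u \<epsilon> z))))"

end

text \<open>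
  In the two schemes the assignment \<open>e\<close> supplies the parameters of the formula \<open>\<phi>\<close>.
\<close>

locale ZF_model = mem_structure +
  assumes extensionality: "(\<forall>z. z \<epsilon> x \<longleftrightarrow> z \<epsilon> y) \<Longrightarrow> x = y"
    and foundation: "\<exists>y. y \<epsilon> x \<Longrightarrow> \<exists>y. y \<epsilon> x \<and> \<not> (\<exists>z. z \<epsilon> x \<and> z \<epsilon> y)"
    and pairing: "\<exists>p. is_upair p a b"
    and union: "\<exists>u. \<forall>z. z \<epsilon> u \<longleftrightarrow> (\<exists>y. y \<epsilon> x \<and> z \<epsilon> y)"
    and powerset: "\<exists>P. \<forall>z. z \<epsilon> P \<longleftrightarrow> is_subset z x"
    and infinity: "\<exists>w. is_inductive w"
    and separation: "\<exists>y. \<forall>z. z \<epsilon> y \<longleftrightarrow> z \<epsilon> x \<and> sat mem (e(0 := z)) \<phi>"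
    and replacement:
      "(\<forall>u v v'. u \<epsilon> x \<and> sat mem (e(0 := u, 1 := v)) \<phi> \<and> sat mem (e(0 := u, 1 := v')) \<phi>
          \<longrightarrow> v = v') \<Longrightarrow>
       \<exists>y. \<forall>v. v \<epsilon> y \<longleftrightarrow> (\<exists>u. u \<epsilon> x \<and> sat mem (e(0 := u, 1 := v)) \<phi>)"

end

theory Submission
  imports Defs
begin

text \<open>
  Let \<open>f\<close> select a 4-element subset of every finite subset of \<open>y\<close> with at least 5 elements. A choice
  function for the \<open>n\<close>-element subsets of \<open>y\<close> yields one for the \<open>(n + 4)\<close>-element subsets,
      applied to
  \<open>z - f z\<close>, so only \<open>n = 1\<close> (trivial) and \<open>n = 7\<close> remain.

  For a 7-element \<open>z\<close> put \<open>A = f z\<close> and \<open>B = z - A\<close>. From a 5-element set, \<open>f\<close> omits one element,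
      so every
  pair \<open>p \<subseteq> A\<close> points to the element of \<open>p \<union> B\<close> omitted by \<open>f\<close>. Let \<open>d x\<close> count the pairs pointing
  to \<open>x\<close>; the sum of \<open>d\<close> over \<open>z\<close> is 6. If \<open>d\<close> is not constant on \<open>B\<close>, then some level set in \<open>B\<close>
      is a
  singleton. If \<open>d\<close> is not constant on \<open>A\<close>, then some level set in \<open>A\<close> is a singleton or a pair,
      and a
  pair points to a single element. If \<open>d\<close> is \<open>u\<close> on \<open>A\<close> and \<open>v\<close> on \<open>B\<close>, then \<open>4 u + 3 v = 6\<close> forces
  \<open>u = 0\<close>, so all pairs of \<open>A\<close> point into \<open>B\<close>. Now each \<open>a \<in> A\<close> determines the pair that remains
      when
  \<open>f\<close> has removed four elements from \<open>z - {a}\<close>, and each pair in \<open>z\<close> singles out an element of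
      \<open>B\<close>. So
  four marks fall on the three elements of \<open>B\<close>, and some multiplicity is attained exactly once.
\<close>

subsection \<open>Definability in the model\<close>

text \<open>Only finitely many variables matter, so a fresh index is available when
  \<open>sat_rename\<close> passes under a quantifier.\<close>

lemma sat_finite_support:
  "\<exists>N. \<forall>e e'. (\<forall>i<N. e i = e' i) \<longrightarrow> sat mem e \<phi> = sat mem e' \<phi>"
proof (induction \<phi>)
  case (Mem i j)
  show ?case by (rule exI[of _ "Suc (max i j)"]) (auto simp: less_Suc_eq_le)
next
  case (Eq i j)
  show ?case by (rule exI[of _ "Suc (max i j)"]) (auto simp: less_Suc_eq_le)
next
  case (Neg p)
  then show ?case by simp
next
  case (Conj p q)
  then obtain N M where
    "\<forall>e e'. (\<forall>i<N. e i = e' i) \<longrightarrow> sat mem e p = sat mem e' p"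
    "\<forall>e e'. (\<forall>i<M. e i = e' i) \<longrightarrow> sat mem e q = sat mem e' q" by blast
  then show ?case
    by (intro exI[of _ "max N M"]) (simp add: less_max_iff_disj, blast)
next
  case (Forall i p)
  then obtain N where N:
    "\<And>e e'. (\<forall>i<N. e i = e' i) \<Longrightarrow> sat mem e p = sat mem e' p" by blast
  show ?case
  proof (intro exI[of _ N] allI impI)
    fix e e' :: "nat \<Rightarrow> 'a" assume "\<forall>i<N. e i = e' i"
    then have "sat mem (e(i := a)) p = sat mem (e'(i := a)) p" for a
      by (intro N) simp
    then show "sat mem e (Forall i p) = sat mem e' (Forall i p)" by simp
  qed
qed

text \<open>This is what lets parameters, arguments and bound variables change places below. Since
  \<open>r\<close> need not be injective, the quantifier case avoids capture by binding a fresh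
  index.\<close>

lemma sat_rename: "\<exists>\<psi>. \<forall>e. sat mem e \<psi> = sat mem (\<lambda>i. e (r i)) \<phi>"
proof (induction \<phi> arbitrary: r)
  case (Mem i j)
  show ?case by (rule exI[of _ "Mem (r i) (r j)"]) simp
next
  case (Eq i j)
  show ?case by (rule exI[of _ "Eq (r i) (r j)"]) simp
next
  case (Neg p)
  then obtain p' where "\<forall>e. sat mem e p' = sat mem (\<lambda>i. e (r i)) p" by blast
  then show ?case by (intro exI[of _ "Neg p'"]) simp
next
  case (Conj p q)
  then obtain p' q' where "\<forall>e. sat mem e p' = sat mem (\<lambda>i. e (r i)) p"
    "\<forall>e. sat mem e q' = sat mem (\<lambda>i. e (r i)) q" by metis
  then show ?case by (intro exI[of _ "Conj p' q'"]) simp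
next
  case (Forall i p)
  obtain N where N: "\<And>e e'. (\<forall>i<N. e i = e' i) \<Longrightarrow> sat mem e p = sat mem e' p"
    using sat_finite_support[of mem p] by blast
  \<comment> \<open>\<open>j\<close> exceeds \<open>r k\<close> for every relevant \<open>k\<close>;
    the range \<open>{..N}\<close> keeps the set nonempty even for \<open>N = 0\<close>.\<close>
  define j where "j = Suc (Max (r ` {..N}))"
  have j: "r k \<noteq> j" if "k < N" for k
  proof -
    have "r k \<le> Max (r ` {..N})" using that by (intro Max_ge) auto
    then show ?thesis unfolding j_def by simp
  qed
  obtain p' where p': "\<And>e. sat mem e p' = sat mem (\<lambda>k. e ((r(i := j)) k)) p"
    using Forall.IH by blast
  have "sat mem (e(j := a)) p' = sat mem ((\<lambda>k. e (r k))(i := a)) p" for e a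
    unfolding p' using j by (intro N) auto
  then show ?case by (intro exI[of _ "Forall j p'"]) simp
qed

context ZF_model
begin

text \<open>Definability by a first-order formula, with parameters \<open>c 0, \<dots>, c (k - 1)\<close> from the model.\<close>

definition definable :: "((nat \<Rightarrow> 'a) \<Rightarrow> bool) \<Rightarrow> bool" where
  "definable P \<longleftrightarrow> (\<exists>\<phi> k c. \<forall>e. P e = sat mem (\<lambda>i. if i < k then c i else e (i - k)) \<phi>)"

text \<open>In the graph of \<open>t\<close> the value has index 0, and the arguments are shifted up by one.\<close>

definition definable_fun :: "((nat \<Rightarrow> 'a) \<Rightarrow> 'a) \<Rightarrow> bool" where
  "definable_fun t \<longleftrightarrow> definable (\<lambda>e. e 0 = t (\<lambda>i. e (Suc i)))"

section \<open>Closure of definability under logical operations and substitution\<close>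

lemma definable_rename:
  assumes "definable P"
  shows "definable (\<lambda>e. P (\<lambda>i. e (r i)))"
proof -
  obtain \<phi> k c where *: "\<And>e. P e = sat mem (\<lambda>i. if i < k then c i else e (i - k)) \<phi>"
    using assms unfolding definable_def by blast
  \<comment> \<open>The first \<open>k\<close> indices hold the parameters and stay fixed;
    \<open>r\<close> acts on the argument block behind them.\<close>
  obtain \<psi> where \<psi>: "\<And>e. sat mem e \<psi> =
      sat mem (\<lambda>i. e ((\<lambda>i. if i < k then i else k + r (i - k)) i)) \<phi>"
    using sat_rename[of mem "\<lambda>i. if i < k then i else k + r (i - k)" "\<phi>"] by auto
  have "P (\<lambda>i. e (r i)) = sat mem (\<lambda>i. if i < k then c i else e (i - k)) \<psi>" for e
    unfolding * \<psi> by (intro arg_cong[where f = "\<lambda>e. sat mem e \<phi>"]) auto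
  then show ?thesis unfolding definable_def by blast
qed

lemma definable_neg:
  assumes "definable P"
  shows "definable (\<lambda>e. \<not> P e)"
proof -
  obtain \<phi> k c where "\<And>e. P e = sat mem (\<lambda>i. if i < k then c i else e (i - k)) \<phi>"
    using assms unfolding definable_def by blast
  then show ?thesis
    unfolding definable_def by (intro exI[of _ "Neg \<phi>"] exI[of _ k] exI[of _ c]) simp
qed

text \<open>The parameter blocks are laid end to end, \<open>c\<close> before \<open>d\<close>. The
  arguments of the first formula shift by \<open>l\<close>, all variables of the second by
  \<open>k\<close>.\<close>

lemma definable_conj:
  assumes "definable P" "definable Q"
  shows "definable (\<lambda>e. P e \<and> Q e)"
proof -
  obtain \<phi> k c where 1: "\<And>e. P e = sat mem (\<lambda>i. if i < k then c i else e (i - k)) \<phi>"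
    using assms unfolding definable_def by blast
  obtain \<psi> l d where 2: "\<And>e. Q e = sat mem (\<lambda>i. if i < l then d i else e (i - l)) \<psi>"
    using assms unfolding definable_def by blast
  obtain \<phi>' where 3: "\<And>e. sat mem e \<phi>' =
      sat mem (\<lambda>i. e ((\<lambda>i. if i < k then i else i + l) i)) \<phi>"
    using sat_rename[of mem "\<lambda>i. if i < k then i else i + l" "\<phi>"] by auto
  obtain \<psi>' where 4: "\<And>e. sat mem e \<psi>' = sat mem (\<lambda>i. e ((\<lambda>i. i + k) i)) \<psi>"
    using sat_rename[of mem "\<lambda>i. i + k" "\<psi>"] by auto
  have "P e \<and> Q e \<longleftrightarrow> sat mem (\<lambda>i. if i < k + l then (\<lambda>i. if i < k then c i else d (i - k)) i
      else e (i - (k + l))) (Conj \<phi>' \<psi>')" for e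
    unfolding sat.simps 3 4 1 2
    by (intro arg_cong2[where f = "(\<and>)"] arg_cong[where f = "\<lambda>e. sat mem e _"])
      (auto simp: fun_eq_iff)
  then show ?thesis
    unfolding definable_def
    by (intro exI[of _ "Conj \<phi>' \<psi>'"] exI[of _ "k + l"]
        exI[of _ "\<lambda>i. if i < k then c i else d (i - k)"]) simp
qed

text \<open>The convention for binding from here on: the bound variable occupies index 0, and the
  outer assignment is shifted up by one.\<close>

lemma definable_all:
  assumes "definable (\<lambda>e. Q (\<lambda>i. e (Suc i)) (e 0))"
  shows "definable (\<lambda>e. \<forall>a. Q e a)"
proof -
  obtain \<phi> k c where
    *: "\<And>e. Q (\<lambda>i. e (Suc i)) (e 0) = sat mem (\<lambda>i. if i < k then c i else e (i - k)) \<phi>"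
    using assms unfolding definable_def by blast
  \<comment> \<open>In \<open>\<phi>\<close> the variable to be bound sits at index
    \<open>k\<close>, right after the parameters. It moves to 0, and the parameters move up by one
    to make room.\<close>
  obtain \<psi> where \<psi>: "\<And>e. sat mem e \<psi> =
      sat mem (\<lambda>i. e ((\<lambda>i. if i < k then Suc i else if i = k then 0 else i) i)) \<phi>"
    using sat_rename[of mem "\<lambda>i. if i < k then Suc i else if i = k then 0 else i" "\<phi>"] by auto
  \<comment> \<open>The free variables shift back down. Indices 0 and 1 both become 0, which is
    harmless because index 0 is bound in \<open>Forall 0 \<psi>\<close>.\<close>
  obtain \<chi> where \<chi>: "\<And>e. sat mem e \<chi> = sat mem (\<lambda>i. e ((\<lambda>i. i - 1) i)) (Forall 0 \<psi>)"
    using sat_rename[of mem "\<lambda>i. i - 1" "(Forall 0 \<psi>)"] by auto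
  have "Q e a = sat mem ((\<lambda>i. if i - 1 < k then c (i - 1) else e (i - 1 - k))(0 := a)) \<psi>" for e a
  proof -
    have "Q e a = sat mem (\<lambda>i. if i < k then c i else case_nat a e (i - k)) \<phi>"
      using *[of "case_nat a e"] by simp
    also have "\<dots> = sat mem ((\<lambda>i. if i - 1 < k then c (i - 1) else e (i - 1 - k))(0 := a)) \<psi>"
      unfolding \<psi>
      by (intro arg_cong[where f = "\<lambda>e. sat mem e \<phi>"])
        (auto simp: fun_eq_iff split: nat.split intro!: arg_cong[where f = e])
    finally show ?thesis .
  qed
  then have "(\<forall>a. Q e a) = sat mem (\<lambda>i. if i < k then c i else e (i - k)) \<chi>" for e
    unfolding \<chi> by simp
  then show ?thesis unfolding definable_def by blast
qed

lemma definable_const: "definable (\<lambda>e. P)"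
proof -
  have "definable (\<lambda>e. True)" "definable (\<lambda>e. False)"
    unfolding definable_def
    by (intro exI[of _ "Forall 0 (Eq 0 0)"] exI[of _ 0], simp)
      (intro exI[of _ "Neg (Forall 0 (Eq 0 0))"] exI[of _ 0], simp)
  then show ?thesis by (cases P) auto
qed

lemma definable_disj: "definable P \<Longrightarrow> definable Q \<Longrightarrow> definable (\<lambda>e. P e \<or> Q e)"
  by (subst not_not[symmetric], subst de_Morgan_disj) (intro definable_neg definable_conj)

lemma definable_imp: "definable P \<Longrightarrow> definable Q \<Longrightarrow> definable (\<lambda>e. P e \<longrightarrow> Q e)"
  unfolding imp_conv_disj by (intro definable_disj definable_neg)

lemma definable_iff: "definable P \<Longrightarrow> definable Q \<Longrightarrow> definable (\<lambda>e. P e \<longleftrightarrow> Q e)"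
  unfolding iff_conv_conj_imp by (intro definable_conj definable_imp)

lemma definable_ex: "definable (\<lambda>e. Q (\<lambda>i. e (Suc i)) (e 0)) \<Longrightarrow> definable (\<lambda>e. \<exists>a. Q e a)"
  by (subst not_not[symmetric], subst not_ex) (intro definable_neg definable_all)

lemma definable_fun_var: "definable_fun (\<lambda>e. e i)"
  unfolding definable_fun_def definable_def
  by (intro exI[of _ "Eq 0 (Suc i)"] exI[of _ 0]) simp

lemma definable_fun_const: "definable_fun (\<lambda>e. c)"
  unfolding definable_fun_def definable_def
  by (intro exI[of _ "Eq 1 0"] exI[of _ 1] exI[of _ "\<lambda>_. c"]) simp

text \<open>A definable function is given only through its graph, so its value is named by a
  quantified variable.\<close>

lemma definable_subst:
  assumes "definable (\<lambda>e. Q (\<lambda>i. e (Suc i)) (e 0))" "definable_fun t"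
  shows "definable (\<lambda>e. Q e (t e))"
proof -
  have "definable (\<lambda>e. \<exists>a. a = t e \<and> Q e a)"
    using assms unfolding definable_fun_def by (intro definable_ex definable_conj)
  then show ?thesis by simp
qed

lemma definable_fun_rename: "definable_fun t \<Longrightarrow> definable_fun (\<lambda>e. t (\<lambda>i. e (r i)))"
  unfolding definable_fun_def
  by (drule definable_rename[where r = "case_nat 0 (\<lambda>i. Suc (r i))"]) simp

lemma definable_subst2:
  assumes "definable (\<lambda>e. Q (e 0) (e 1))" "definable_fun t" "definable_fun s"
  shows "definable (\<lambda>e. Q (t e) (s e))"
proof -
  have "definable (\<lambda>e. Q (e 0) (s (\<lambda>i. e (Suc i))))"
  proof (rule definable_subst[OF _ definable_fun_rename[OF \<open>definable_fun s\<close>, of Suc]])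
    show "definable (\<lambda>e. Q (e (Suc 0)) (e 0))"
      using definable_rename[OF assms(1), of "\<lambda>i. if i = 0 then Suc 0 else 0"] by simp
  qed
  then show ?thesis
    by (rule definable_subst[OF _ \<open>definable_fun t\<close>])
qed

lemma definable_mem: "definable_fun t \<Longrightarrow> definable_fun s \<Longrightarrow> definable (\<lambda>e. t e \<epsilon> s e)"
proof (rule definable_subst2)
  show "definable (\<lambda>e. e 0 \<epsilon> e 1)"
    unfolding definable_def by (intro exI[of _ "Mem 0 1"] exI[of _ 0]) simp
qed

lemma definable_eq: "definable_fun t \<Longrightarrow> definable_fun s \<Longrightarrow> definable (\<lambda>e. t e = s e)"
proof (rule definable_subst2)
  show "definable (\<lambda>e. e 0 = e 1)"
    unfolding definable_def by (intro exI[of _ "Eq 0 1"] exI[of _ 0]) simp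
qed

lemma definable_ex1:
  assumes "definable (\<lambda>e. Q (\<lambda>i. e (Suc i)) (e 0))"
  shows "definable (\<lambda>e. \<exists>!a. Q e a)"
proof -
  have "definable (\<lambda>e. Q (\<lambda>i. e (Suc (Suc i))) (e 0))"
    using definable_rename[OF assms, of "case_nat 0 (\<lambda>i. Suc (Suc i))"] by simp
  then have "definable (\<lambda>e. \<exists>a. Q e a \<and> (\<forall>b. Q e b \<longrightarrow> b = a))"
    using assms by (intro definable_ex definable_conj definable_all definable_imp definable_eq
        definable_fun_var)
  then show ?thesis unfolding Ex1_def .
qed

lemma definable_fun_if:
  "definable P \<Longrightarrow> definable_fun t \<Longrightarrow> definable_fun s \<Longrightarrow> definable_fun (\<lambda>e. if P e then t e else s e)"
proof -
  assume P: "definable P" and ts: "definable_fun t" "definable_fun s"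
  have "definable (\<lambda>e. P (\<lambda>i. e (Suc i)))" using definable_rename[OF P] .
  then have "definable (\<lambda>e. (P (\<lambda>i. e (Suc i)) \<and> e 0 = t (\<lambda>i. e (Suc i))) \<or>
     (\<not> P (\<lambda>i. e (Suc i)) \<and> e 0 = s (\<lambda>i. e (Suc i))))"
    using ts unfolding definable_fun_def by (intro definable_disj definable_conj definable_neg)
  then show ?thesis unfolding definable_fun_def by (rule back_subst[where P = definable]) auto
qed

lemma definable_fun_subst1: 
  assumes "definable_fun (\<lambda>e. t (e 0))" "definable_fun s"
  shows "definable_fun (\<lambda>e. t (s e))"
proof -
  have "definable (\<lambda>e. e 1 = t (e 0))"
    using definable_rename[OF assms(1)[unfolded definable_fun_def], of "\<lambda>i. if i = 0 then 1 else
        0"] by simp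
  from definable_subst2[OF this definable_fun_rename[OF assms(2), of Suc] definable_fun_var[of 0]]
  show ?thesis unfolding definable_fun_def by simp
qed

text \<open>Unlike \<open>The\<close>, the value of \<open>iota\<close> is the same for all predicates without a unique witness,
  which makes \<open>iota\<close> definable.\<close>

definition iota :: "('a \<Rightarrow> bool) \<Rightarrow> 'a" where
  "iota P = (if \<exists>!x. P x then THE x. P x else undefined)"

lemma iota_eq: "\<exists>!x. P x \<Longrightarrow> P x \<Longrightarrow> iota P = x"
  unfolding iota_def by (simp add: the1_equality)

lemma iotaI: "\<exists>!x. P x \<Longrightarrow> P (iota P)"
  unfolding iota_def by (simp add: theI')

lemma definable_fun_iota:
  assumes "definable (\<lambda>e. Q (\<lambda>i. e (Suc i)) (e 0))"
  shows "definable_fun (\<lambda>e. iota (Q e))"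
proof -
  have Q': "definable (\<lambda>e. Q (\<lambda>i. e (Suc (Suc i))) (e 0))"
    using definable_rename[OF assms, of "case_nat 0 (\<lambda>i. Suc (Suc i))"] by simp
  \<comment> \<open>The default value \<open>undefined\<close> is an element of the model and serves
    as a parameter of the formula.\<close>
  have "definable (\<lambda>e. if \<exists>!a. Q (\<lambda>i. e (Suc i)) a then Q (\<lambda>i. e (Suc i)) (e 0) else e 0 =
      undefined)"
    unfolding if_bool_eq_disj
    by (intro definable_disj definable_conj definable_neg definable_ex1 Q' assms definable_eq
        definable_fun_var definable_fun_const)
  moreover have "(if \<exists>!a. R a then R x else x = undefined) \<longleftrightarrow> x = iota R" for R x
    unfolding iota_def using theI'[of R] by auto
  ultimately show ?thesis
    unfolding definable_fun_def by simp
qed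

lemmas definable_logic = definable_neg definable_conj definable_disj definable_imp definable_iff
    definable_all definable_ex definable_ex1
  definable_mem definable_eq definable_fun_if definable_fun_iota definable_fun_var
      definable_fun_const

section \<open>Separation and comprehension terms\<close>

lemma separation_definable:
  assumes "definable (\<lambda>e. P (e 0))"
  shows "\<exists>s. \<forall>z. z \<epsilon> s \<longleftrightarrow> z \<epsilon> x \<and> P z"
proof -
  obtain \<phi> k c where *: "\<And>e. P (e 0) = sat mem (\<lambda>i. if i < k then c i else e (i - k)) \<phi>"
    using assms unfolding definable_def by blast
  \<comment> \<open>\<open>separation\<close> expects the element at index 0, so the parameters move
    to the indices from 1 on. All argument indices may collapse to 0, since \<open>P\<close> looks
    at \<open>e 0\<close> only.\<close>
  obtain \<psi> where \<psi>: "\<And>e. sat mem e \<psi> = sat mem (\<lambda>i. e ((\<lambda>i. if i < k then Suc i else 0) i)) \<phi>"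
    using sat_rename[of mem "\<lambda>i. if i < k then Suc i else 0" "\<phi>"] by auto
  have "P z = sat mem ((\<lambda>i. c (i - 1))(0 := z)) \<psi>" for z
    using *[of "\<lambda>_. z"] unfolding \<psi>
    by (auto intro!: arg_cong[where f = "\<lambda>e. sat mem e \<phi>"] simp: fun_eq_iff)
  then show ?thesis using separation[of x "\<lambda>i. c (i - 1)" \<psi>] by simp
qed

text \<open>Being total by way of \<open>iota\<close>, this is definable without side conditions; it
  is meaningful only once the class is known to be a set.\<close>

definition coll :: "('a \<Rightarrow> bool) \<Rightarrow> 'a" where
  "coll P = iota (\<lambda>s. \<forall>x. x \<epsilon> s \<longleftrightarrow> P x)"

lemma mem_coll_ex: "\<exists>s. \<forall>x. x \<epsilon> s \<longleftrightarrow> P x \<Longrightarrow> x \<epsilon> coll P \<longleftrightarrow> P x"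
proof -
  assume "\<exists>s. \<forall>x. x \<epsilon> s \<longleftrightarrow> P x"
  then have "\<exists>!s. \<forall>x. x \<epsilon> s \<longleftrightarrow> P x" using extensionality by metis
  from iotaI[OF this] show ?thesis unfolding coll_def by blast
qed

lemma definable_fun_coll:
  assumes "definable (\<lambda>e. Q (\<lambda>i. e (Suc i)) (e 0))"
  shows "definable_fun (\<lambda>e. coll (Q e))"
proof -
  have "definable (\<lambda>e. Q (\<lambda>i. e (Suc (Suc i))) (e 0))"
    using definable_rename[OF assms, of "case_nat 0 (\<lambda>i. Suc (Suc i))"] by simp
  then show ?thesis unfolding coll_def by (intro definable_logic)
qed

lemma mem_sep: "definable (\<lambda>e. P (e 0)) \<Longrightarrow> x \<epsilon> coll (\<lambda>x. x \<epsilon> z \<and> P x) \<longleftrightarrow> x \<epsilon> z \<and> P x"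
  by (rule mem_coll_ex) (rule separation_definable)

subsection \<open>Elementary set theory in the model\<close>

text \<open>The pattern of the closure lemmas that follow: the notion unfolds to its first-order
  formula, and \<open>definable_fun_rename\<close> re-indexes the argument terms under each
  quantifier.\<close>

lemma definable_is_subset:
  "definable_fun x \<Longrightarrow> definable_fun y \<Longrightarrow> definable (\<lambda>e. is_subset (x e) (y e))"
  unfolding is_subset_def by (intro definable_logic; erule definable_fun_rename)

lemma definable_is_empty: "definable_fun x \<Longrightarrow> definable (\<lambda>e. is_empty (x e))"
  unfolding is_empty_def by (intro definable_logic; erule definable_fun_rename)

lemma definable_is_succ: "definable_fun x \<Longrightarrow> definable_fun y \<Longrightarrow> definable (\<lambda>e. is_succ (x e) (y e))"
  unfolding is_succ_def by (intro definable_logic; erule definable_fun_rename)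

lemma definable_is_upair:
  "definable_fun x \<Longrightarrow> definable_fun y \<Longrightarrow> definable_fun z \<Longrightarrow> definable (\<lambda>e. is_upair (x e) (y e) (z e))"
  unfolding is_upair_def by (intro definable_logic; erule definable_fun_rename)

lemma definable_is_pair:
  "definable_fun x \<Longrightarrow> definable_fun y \<Longrightarrow> definable_fun z \<Longrightarrow> definable (\<lambda>e. is_pair (x e) (y e) (z e))"
  unfolding is_pair_def by (intro definable_logic definable_is_upair; erule definable_fun_rename)

lemma definable_maps_to:
  "definable_fun x \<Longrightarrow> definable_fun y \<Longrightarrow> definable_fun z \<Longrightarrow> definable (\<lambda>e. maps_to (x e) (y e) (z e))"
  unfolding maps_to_def by (intro definable_logic definable_is_pair; erule definable_fun_rename)

lemma definable_is_inductive: "definable_fun x \<Longrightarrow> definable (\<lambda>e. is_inductive (x e))"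
  unfolding is_inductive_def
  by (intro definable_logic definable_is_empty definable_is_succ; erule definable_fun_rename)

lemma definable_is_natural: "definable_fun x \<Longrightarrow> definable (\<lambda>e. is_natural (x e))"
  unfolding is_natural_def
  by (intro definable_logic definable_is_inductive; erule definable_fun_rename)

lemma definable_is_function:
  "definable_fun x \<Longrightarrow> definable_fun y \<Longrightarrow> definable_fun z \<Longrightarrow> definable (\<lambda>e. is_function (x e) (y e) (z
      e))"
  unfolding is_function_def
  by (intro definable_logic definable_is_pair definable_maps_to; erule definable_fun_rename)

lemma definable_equinumerous:
  "definable_fun x \<Longrightarrow> definable_fun y \<Longrightarrow> definable (\<lambda>e. equinumerous (x e) (y e))"
  unfolding equinumerous_def is_bijection_def
  by (intro definable_logic definable_is_function definable_maps_to; erule definable_fun_rename)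

lemma definable_is_sum:
  "definable_fun x \<Longrightarrow> definable_fun y \<Longrightarrow> definable_fun z \<Longrightarrow> definable (\<lambda>e. is_sum (x e) (y e) (z e))"
  unfolding is_sum_def is_omega_def
  by (intro definable_logic definable_is_natural definable_is_function definable_is_empty
      definable_maps_to definable_is_succ; erule definable_fun_rename)

lemma definable_is_subsets_of_size:
  "definable_fun x \<Longrightarrow> definable_fun y \<Longrightarrow> definable_fun z \<Longrightarrow> definable (\<lambda>e. is_subsets_of_size (x e)
      (y e) (z e))"
  unfolding is_subsets_of_size_def
  by (intro definable_logic definable_is_subset definable_equinumerous; erule definable_fun_rename)

section \<open>Set operations as definable terms\<close>

definition upair :: "'a \<Rightarrow> 'a \<Rightarrow> 'a" where "upair a b = coll (\<lambda>x. x = a \<or> x = b)"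
definition opair :: "'a \<Rightarrow> 'a \<Rightarrow> 'a" where "opair a b = upair (upair a a) (upair a b)"
definition bin_union :: "'a \<Rightarrow> 'a \<Rightarrow> 'a" where "bin_union x y = coll (\<lambda>z. z \<epsilon> x \<or> z \<epsilon> y)"
definition set_diff :: "'a \<Rightarrow> 'a \<Rightarrow> 'a" where "set_diff x y = coll (\<lambda>z. z \<epsilon> x \<and> \<not> z \<epsilon> y)"
definition succ :: "'a \<Rightarrow> 'a" where "succ x = coll (\<lambda>z. z \<epsilon> x \<or> z = x)"
definition emp :: "'a" where "emp = coll (\<lambda>_. False)"
definition app :: "'a \<Rightarrow> 'a \<Rightarrow> 'a" where "app f x = iota (maps_to f x)"

lemma definable_fun_upair:
  "definable_fun t \<Longrightarrow> definable_fun s \<Longrightarrow> definable_fun (\<lambda>e. upair (t e) (s e))"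
  unfolding upair_def by (intro definable_fun_coll definable_logic; erule definable_fun_rename)

lemma definable_fun_opair:
  "definable_fun t \<Longrightarrow> definable_fun s \<Longrightarrow> definable_fun (\<lambda>e. opair (t e) (s e))"
  unfolding opair_def by (intro definable_fun_upair)

lemma definable_fun_bin_union:
  "definable_fun t \<Longrightarrow> definable_fun s \<Longrightarrow> definable_fun (\<lambda>e. bin_union (t e) (s e))"
  unfolding bin_union_def by (intro definable_fun_coll definable_logic; erule definable_fun_rename)

lemma definable_fun_set_diff:
  "definable_fun t \<Longrightarrow> definable_fun s \<Longrightarrow> definable_fun (\<lambda>e. set_diff (t e) (s e))"
  unfolding set_diff_def by (intro definable_fun_coll definable_logic; erule definable_fun_rename)

lemma definable_fun_succ: "definable_fun t \<Longrightarrow> definable_fun (\<lambda>e. succ (t e))"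
  unfolding succ_def by (intro definable_fun_coll definable_logic; erule definable_fun_rename)

lemma definable_fun_app: "definable_fun t \<Longrightarrow> definable_fun s \<Longrightarrow> definable_fun (\<lambda>e. app (t e) (s e))"
  unfolding app_def
  by (intro definable_fun_iota definable_maps_to definable_logic; erule definable_fun_rename)

lemmas definable_intros = definable_logic definable_is_subset definable_is_empty definable_is_succ
    definable_is_pair definable_maps_to
  definable_is_natural definable_is_function definable_equinumerous definable_is_sum
      definable_is_subsets_of_size
  definable_fun_upair definable_fun_opair definable_fun_bin_union definable_fun_set_diff
      definable_fun_succ definable_fun_app

lemma mem_upair [simp]: "x \<epsilon> upair a b \<longleftrightarrow> x = a \<or> x = b"
  unfolding upair_def using pairing[of a b] unfolding is_upair_def by (rule mem_coll_ex)

lemma mem_bin_union [simp]: "x \<epsilon> bin_union a b \<longleftrightarrow> x \<epsilon> a \<or> x \<epsilon> b"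
  unfolding bin_union_def
proof (rule mem_coll_ex)
  obtain u where "\<And>z. z \<epsilon> u \<longleftrightarrow> (\<exists>y. y \<epsilon> upair a b \<and> z \<epsilon> y)" using union[of "upair a b"] by blast
  then show "\<exists>s. \<forall>x. x \<epsilon> s \<longleftrightarrow> x \<epsilon> a \<or> x \<epsilon> b" by (intro exI[of _ u]) auto
qed

lemma mem_set_diff [simp]: "x \<epsilon> set_diff a b \<longleftrightarrow> x \<epsilon> a \<and> \<not> x \<epsilon> b"
  unfolding set_diff_def by (rule mem_sep) (intro definable_intros)

lemma mem_emp [simp]: "\<not> x \<epsilon> emp"
proof -
  have "\<exists>s. \<forall>x. x \<epsilon> s \<longleftrightarrow> False" using separation_definable[OF definable_const[of False]] by simp
  from mem_coll_ex[OF this] show ?thesis unfolding emp_def by simp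
qed

lemma succ_eq_bin_union: "succ x = bin_union x (upair x x)"
  unfolding succ_def bin_union_def by simp

lemma mem_succ [simp]: "z \<epsilon> succ x \<longleftrightarrow> z \<epsilon> x \<or> z = x"
  unfolding succ_eq_bin_union by simp

lemma elts_eqI: "(\<And>z. z \<epsilon> x \<longleftrightarrow> z \<epsilon> y) \<Longrightarrow> x = y"
  using extensionality by blast

lemma is_upair_iff: "is_upair p a b \<longleftrightarrow> p = upair a b"
  unfolding is_upair_def by (auto intro: elts_eqI)

lemma is_pair_iff: "is_pair p a b \<longleftrightarrow> p = opair a b"
  unfolding is_pair_def is_upair_iff opair_def by simp

lemma is_succ_iff: "is_succ s x \<longleftrightarrow> s = succ x"
  unfolding is_succ_def by (auto intro: elts_eqI)

lemma is_empty_iff: "is_empty x \<longleftrightarrow> x = emp"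
  unfolding is_empty_def by (auto intro: elts_eqI)

lemma maps_to_iff: "maps_to f a b \<longleftrightarrow> opair a b \<epsilon> f"
  unfolding maps_to_def is_pair_iff by simp

lemma upair_eq_iff: "upair a b = upair c d \<longleftrightarrow> a = c \<and> b = d \<or> a = d \<and> b = c"
proof
  assume *: "upair a b = upair c d"
  have "x = a \<or> x = b \<longleftrightarrow> x = c \<or> x = d" for x
    using mem_upair[of x a b] unfolding * by simp
  then have "{a, b} = {c, d}" by auto
  then show "a = c \<and> b = d \<or> a = d \<and> b = c" unfolding doubleton_eq_iff .
qed (auto intro: elts_eqI)

lemma opair_inject [simp]: "opair a b = opair c d \<longleftrightarrow> a = c \<and> b = d"
  unfolding opair_def upair_eq_iff by auto

text \<open>The graph is separated from the double power set of the union of \<open>A\<close> and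
  \<open>B\<close>, which contains all the Kuratowski pairs involved. This turns definable
  operations into functions of the model; \<open>is_function_app\<close> goes the other way.\<close>

lemma function_ex:
  assumes t: "definable_fun (\<lambda>e. t (e 0))" and AB: "\<And>a. a \<epsilon> A \<Longrightarrow> t a \<epsilon> B"
  shows "\<exists>f. is_function f A B \<and> (\<forall>a u. maps_to f a u \<longleftrightarrow> a \<epsilon> A \<and> u = t a)"
proof -
  obtain P where P: "\<And>z. z \<epsilon> P \<longleftrightarrow> is_subset z (bin_union A B)" using powerset by blast
  obtain PP where PP: "\<And>z. z \<epsilon> PP \<longleftrightarrow> is_subset z P" using powerset by blast
  have "definable (\<lambda>e. \<exists>a. a \<epsilon> A \<and> e 0 = opair a (t a))"
    by (intro definable_intros definable_fun_subst1[OF t])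
  then obtain f where f: "\<And>p. p \<epsilon> f \<longleftrightarrow> p \<epsilon> PP \<and> (\<exists>a. a \<epsilon> A \<and> p = opair a (t a))"
    using separation_definable[of "\<lambda>p. \<exists>a. a \<epsilon> A \<and> p = opair a (t a)" PP] by auto
  have "opair a (t a) \<epsilon> PP" if "a \<epsilon> A" for a
    unfolding PP is_subset_def opair_def mem_upair P using that AB by auto
  then have "p \<epsilon> f \<longleftrightarrow> (\<exists>a. a \<epsilon> A \<and> p = opair a (t a))" for p using f by blast
  then have "\<forall>a u. maps_to f a u \<longleftrightarrow> a \<epsilon> A \<and> u = t a"
    "p \<epsilon> f \<Longrightarrow> \<exists>a b. a \<epsilon> A \<and> b \<epsilon> B \<and> is_pair p a b" for p
    unfolding maps_to_iff is_pair_iff using AB by auto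
  then show ?thesis unfolding is_function_def using AB by (intro exI[of _ f]) auto
qed

lemma is_function_app:
  assumes "is_function f A B" "a \<epsilon> A"
  shows "app f a \<epsilon> B" "maps_to f a b \<longleftrightarrow> b = app f a"
proof -
  have B: "b' \<epsilon> B" if "maps_to f a b'" for b'
  proof -
    have "opair a b' \<epsilon> f" using that unfolding maps_to_iff .
    then show ?thesis using assms unfolding is_function_def is_pair_iff by (metis opair_inject)
  qed
  moreover have "\<exists>!b. b \<epsilon> B \<and> maps_to f a b"
    using assms unfolding is_function_def by simp
  ultimately have *: "\<exists>!b. maps_to f a b" by metis
  then show "maps_to f a b \<longleftrightarrow> b = app f a"
    unfolding app_def using iotaI[OF *] * by metis
  show "app f a \<epsilon> B" unfolding app_def by (rule B[OF iotaI[OF *]])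
qed

text \<open>The extension as an HOL set, so that \<open>finite\<close>, \<open>card\<close> and
  \<open>bij_betw\<close> of HOL become available.\<close>

definition elts :: "'a \<Rightarrow> 'a set" where "elts x = {z. z \<epsilon> x}"

lemma mem_elts [simp]: "z \<in> elts x \<longleftrightarrow> z \<epsilon> x"
  unfolding elts_def by simp

text \<open>Definability of \<open>t\<close> is essential, since an arbitrary HOL bijection need not
  belong to the model. Forwards, \<open>t\<close> is \<open>app f\<close> with the bijection
  \<open>f\<close> as a parameter; backwards, \<open>function_ex\<close> applies.\<close>

lemma equinumerous_iff:
  "equinumerous A B \<longleftrightarrow> (\<exists>t. definable_fun (\<lambda>e. t (e 0)) \<and> bij_betw t (elts A) (elts B))"
proof
  assume "equinumerous A B"
  then obtain f where f: "is_function f A B" "\<And>b. b \<epsilon> B \<Longrightarrow> \<exists>!a. a \<epsilon> A \<and> maps_to f a b"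
    unfolding equinumerous_def is_bijection_def by blast
  have "bij_betw (app f) (elts A) (elts B)"
    unfolding bij_betw_def
  proof
    show "inj_on (app f) (elts A)"
    proof (rule inj_onI)
      fix x y assume "x \<in> elts A" "y \<in> elts A" and eq: "app f x = app f y"
      then have "x \<epsilon> A" "y \<epsilon> A" by simp_all
      then show "x = y"
        using f(2)[OF is_function_app(1)[OF f(1)], of x] eq is_function_app(2)[OF f(1)] by blast
    qed
    show "app f ` elts A = elts B"
    proof (intro equalityI subsetI)
      fix b assume "b \<in> elts B"
      then obtain a where "a \<epsilon> A" "maps_to f a b" using f(2)[of b] unfolding mem_elts by blast
      then show "b \<in> app f ` elts A" using is_function_app(2)[OF f(1)] by auto
    next
      fix b assume "b \<in> app f ` elts A"
      then obtain a where "a \<epsilon> A" "b = app f a" by auto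
      then show "b \<in> elts B" using is_function_app(1)[OF f(1)] by simp
    qed
  qed
  then show "\<exists>t. definable_fun (\<lambda>e. t (e 0)) \<and> bij_betw t (elts A) (elts B)"
    by (intro exI[of _ "app f"] conjI definable_intros)
next
  assume "\<exists>t. definable_fun (\<lambda>e. t (e 0)) \<and> bij_betw t (elts A) (elts B)"
  then obtain t where t: "definable_fun (\<lambda>e. t (e 0))" and b: "bij_betw t (elts A) (elts B)" by
      blast
  from b have tB: "t a \<epsilon> B" if "a \<epsilon> A" for a using that unfolding bij_betw_def by auto
  from function_ex[OF t tB] obtain f where f: "is_function f A B"
    "\<And>a u. maps_to f a u \<longleftrightarrow> a \<epsilon> A \<and> u = t a" by blast
  have "\<exists>!a. a \<epsilon> A \<and> maps_to f a x" if "x \<epsilon> B" for x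
  proof -
    have "x \<in> t ` elts A" using b that unfolding bij_betw_def by simp
    then obtain a where "a \<epsilon> A" "x = t a" by auto
    moreover have "a' = a" if "a' \<epsilon> A" "t a' = t a" for a'
      using b that \<open>a \<epsilon> A\<close> unfolding bij_betw_def inj_on_def by auto
    ultimately show ?thesis unfolding f(2) by (intro ex1I[of _ a]) simp_all
  qed
  then show "equinumerous A B"
    using f(1) unfolding equinumerous_def is_bijection_def by (intro exI[of _ f]) simp
qed

lemma equinumerousI: "definable_fun (\<lambda>e. t (e 0)) \<Longrightarrow> bij_betw t (elts A) (elts B) \<Longrightarrow> equinumerous A B"
  unfolding equinumerous_iff by (intro exI[of _ t] conjI)

section \<open>Internal sizes and standard numerals\<close>

lemma mem_irrefl: "\<not> x \<epsilon> x"
  using foundation[of "upair x x"] by auto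

lemma mem_asym: "x \<epsilon> y \<Longrightarrow> \<not> y \<epsilon> x"
  using foundation[of "upair x y"] by auto

lemma succ_inject [simp]: "succ x = succ y \<longleftrightarrow> x = y"
  by (metis mem_succ mem_asym)

lemma succ_neq_emp [simp]: "succ x \<noteq> emp"
  by (metis mem_succ mem_emp)

text \<open>Any \<open>a\<close> may be removed, even if the given bijection does not send it to the
  last element \<open>m\<close>: whatever goes to \<open>m\<close> is redirected to the image of
  \<open>a\<close>. Conversely, \<open>a\<close> is sent to \<open>m\<close>. Nothing is assumed of
  \<open>m\<close>, so nonstandard sizes are covered.\<close>

lemma equinumerous_succ:
  assumes "a \<epsilon> z"
  shows "equinumerous z (succ m) \<longleftrightarrow> equinumerous (set_diff z (upair a a)) m"
proof
  assume "equinumerous z (succ m)"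
  then obtain t where t: "definable_fun (\<lambda>e. t (e 0))" and b: "bij_betw t (elts z) (elts (succ m))"
    unfolding equinumerous_iff by blast
  define s where "s x = (if t x = m then t a else t x)" for x
  have i: "t x = t y \<longleftrightarrow> x = y" if "x \<epsilon> z" "y \<epsilon> z" for x y
    using b that unfolding bij_betw_def inj_on_def by auto
  have r: "t x \<epsilon> m \<or> t x = m" if "x \<epsilon> z" for x
    using b that unfolding bij_betw_def by auto
  have r': "\<exists>x. x \<epsilon> z \<and> y = t x" if "y \<epsilon> m \<or> y = m" for y
  proof -
    have "y \<in> t ` elts z" using b that unfolding bij_betw_def by simp
    then show ?thesis by auto
  qed
  have "bij_betw s (elts (set_diff z (upair a a))) (elts m)"
    unfolding bij_betw_def
  proof
    show "inj_on s (elts (set_diff z (upair a a)))"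
      unfolding inj_on_def s_def using i assms by auto
    show "s ` elts (set_diff z (upair a a)) = elts m"
    proof (intro equalityI subsetI)
      fix y assume "y \<in> s ` elts (set_diff z (upair a a))"
      then obtain x where x: "x \<epsilon> z" "x \<noteq> a" "y = s x" by auto
      show "y \<in> elts m"
      proof (cases "t x = m")
        case True
        then have "t a \<noteq> m" using i[OF x(1) assms] x by auto
        then show ?thesis using True x r[OF assms] unfolding s_def by simp
      next
        case False
        then show ?thesis using x r[OF x(1)] unfolding s_def by simp
      qed
    next
      fix y assume "y \<in> elts m"
      then have y: "y \<epsilon> m" "y \<noteq> m" using mem_irrefl by auto
      then obtain x where x: "x \<epsilon> z" "y = t x" using r' by blast
      \<comment> \<open>If \<open>y\<close> is the image of the removed \<open>a\<close>, then
        \<open>x0\<close> takes its place as the preimage under \<open>s\<close>.\<close>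
      obtain x0 where x0: "x0 \<epsilon> z" "m = t x0" using r' by blast
      show "y \<in> s ` elts (set_diff z (upair a a))"
      proof (cases "x = a")
        case True
        then have "y = s x0" "x0 \<noteq> a" using x x0 y unfolding s_def by auto
        then show ?thesis using x0 by auto
      next
        case False
        then have "y = s x" using x y unfolding s_def by auto
        then show ?thesis using x False by auto
      qed
    qed
  qed
  moreover have "definable_fun (\<lambda>e. s (e 0))" unfolding s_def by (intro definable_intros t)
  ultimately show "equinumerous (set_diff z (upair a a)) m" by (intro equinumerousI)
next
  assume "equinumerous (set_diff z (upair a a)) m"
  then obtain t where t: "definable_fun (\<lambda>e. t (e 0))" and b: "bij_betw t (elts (set_diff z (upair
      a a))) (elts m)"
    unfolding equinumerous_iff by blast
  define s where "s x = (if x = a then m else t x)" for x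
  have "bij_betw s (elts (set_diff z (upair a a))) (elts m)"
    using b by (subst bij_betw_cong[of _ s t]) (simp_all add: s_def)
  then have "bij_betw s (elts (set_diff z (upair a a)) \<union> {a}) (elts m \<union> {s a})"
    by (intro notIn_Un_bij_betw) (simp_all add: s_def mem_irrefl)
  moreover have "elts (set_diff z (upair a a)) \<union> {a} = elts z" using assms by auto
  moreover have "elts m \<union> {s a} = elts (succ m)" by (auto simp: s_def)
  ultimately have "bij_betw s (elts z) (elts (succ m))" by simp
  moreover have "definable_fun (\<lambda>e. s (e 0))" unfolding s_def by (intro definable_intros t)
  ultimately show "equinumerous z (succ m)" by (intro equinumerousI)
qed

lemma equinumerous_emp: "equinumerous z emp \<longleftrightarrow> z = emp"
proof
  assume "equinumerous z emp"
  then obtain t where "t ` elts z = elts emp"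
    unfolding equinumerous_iff bij_betw_def by blast
  then have "elts z = {}" by auto
  then show "z = emp" unfolding elts_def by (intro elts_eqI) auto
next
  assume "z = emp"
  then show "equinumerous z emp"
    by (intro equinumerousI[of "\<lambda>x. x"] definable_intros) (simp add: bij_betw_def)
qed

definition numeral_of :: "nat \<Rightarrow> 'a" where "numeral_of k = (succ ^^ k) emp"

lemma numeral_of_simps [simp]: "numeral_of 0 = emp" "numeral_of (Suc k) = succ (numeral_of k)"
  unfolding numeral_of_def by simp_all

lemma is_numeral_iff: "is_numeral k v \<longleftrightarrow> v = numeral_of k"
  by (induction k arbitrary: v) (auto simp: is_empty_iff is_succ_iff)

lemma elts_set_diff_single: "elts (set_diff z (upair a a)) = elts z - {a}"
  by auto

text \<open>For standard sizes, internal and external cardinality agree, by removing one element at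
  a time. The naturals of the model may include others, for which there is no such external
  description.\<close>

lemma equinumerous_numeral_of: "equinumerous z (numeral_of k) \<longleftrightarrow> finite (elts z) \<and> card (elts z) = k"
proof (induction k arbitrary: z)
  case 0
  have "z = emp \<longleftrightarrow> elts z = {}" unfolding elts_def by (auto intro: elts_eqI)
  then show ?case by (auto simp: equinumerous_emp)
next
  case (Suc k)
  show ?case
  proof (cases "\<exists>a. a \<epsilon> z")
    case True
    then obtain a where a: "a \<epsilon> z" by blast
    have "finite S \<and> card S = Suc k \<longleftrightarrow> finite (S - {a}) \<and> card (S - {a}) = k" if "a \<in> S" for S
      using that card_Suc_Diff1[of S a] by auto
    then show ?thesis
      using a equinumerous_succ[OF a, of "numeral_of k"] Suc.IH[of "set_diff z (upair a a)"]
      by (simp add: elts_set_diff_single)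
  next
    case False
    then have "elts z = {}" by auto
    moreover have "\<not> equinumerous z (succ (numeral_of k))"
    proof
      assume "equinumerous z (succ (numeral_of k))"
      then obtain t where "t ` elts z = elts (succ (numeral_of k))"
        unfolding equinumerous_iff bij_betw_def by blast
      moreover have "numeral_of k \<in> elts (succ (numeral_of k))" by simp
      ultimately show False using \<open>elts z = {}\<close> by auto
    qed
    ultimately show ?thesis by simp
  qed
qed

section \<open>Induction and addition on the naturals of the model\<close>

lemma is_inductive_iff: "is_inductive w \<longleftrightarrow> emp \<epsilon> w \<and> (\<forall>x. x \<epsilon> w \<longrightarrow> succ x \<epsilon> w)"
  unfolding is_inductive_def is_empty_iff is_succ_iff by simp

lemma is_natural_emp: "is_natural emp"
  unfolding is_natural_def is_inductive_iff by blast

lemma is_natural_succ: "is_natural x \<Longrightarrow> is_natural (succ x)"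
  unfolding is_natural_def is_inductive_iff by blast

text \<open>Definability of \<open>P\<close> is needed because the naturals of the model may be
  nonstandard: only then does Separation yield an inductive set of naturals satisfying
  \<open>P\<close>.\<close>

lemma natural_induct [consumes 1, case_names definable emp succ]:
  assumes "is_natural n" "definable (\<lambda>e. P (e 0))" "P emp"
    and "\<And>x. is_natural x \<Longrightarrow> P x \<Longrightarrow> P (succ x)"
  shows "P n"
proof -
  obtain w where w: "is_inductive w" using infinity by blast
  have "definable (\<lambda>e. is_natural (e 0) \<and> P (e 0))" by (intro definable_intros assms(2))
  then obtain v where v: "\<And>z. z \<epsilon> v \<longleftrightarrow> z \<epsilon> w \<and> is_natural z \<and> P z"
    using separation_definable[of "\<lambda>x. is_natural x \<and> P x" w] by auto
  have "is_inductive v"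
    unfolding is_inductive_iff v
    using w is_natural_emp is_natural_succ assms unfolding is_inductive_iff by blast
  then show ?thesis using assms(1) v unfolding is_natural_def by blast
qed

lemma is_sum_iff:
  "is_sum d m k \<longleftrightarrow>
     (\<exists>w g. (\<forall>n. n \<epsilon> w \<longleftrightarrow> is_natural n) \<and> is_function g w w \<and> maps_to g emp m \<and>
        (\<forall>i j. i \<epsilon> w \<longrightarrow> maps_to g i j \<longrightarrow> maps_to g (succ i) (succ j)) \<and> maps_to g k d)"
  unfolding is_sum_def is_empty_iff is_succ_iff is_omega_def by (simp add: imp_conjL)

lemma is_sum_emp:
  assumes "is_sum d emp emp"
  shows "d = emp"
proof -
  obtain w g where w: "\<And>n. n \<epsilon> w \<longleftrightarrow> is_natural n" and g: "is_function g w w"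
    and "maps_to g emp emp" "maps_to g emp d"
    using assms unfolding is_sum_iff by blast
  moreover have "emp \<epsilon> w" using w is_natural_emp by simp
  ultimately show ?thesis using is_function_app(2)[OF g] by simp
qed

lemma is_sum_natural:
  assumes "is_sum d m k"
  shows "is_natural d"
proof -
  obtain w g where "\<And>n. n \<epsilon> w \<longleftrightarrow> is_natural n" "is_function g w w" "maps_to g k d"
    using assms unfolding is_sum_iff by blast
  then show ?thesis unfolding is_function_def maps_to_iff is_pair_iff by fastforce
qed

text \<open>If \<open>g\<close> computes \<open>(k + 1) + i\<close>, then all its values are
  successors, and their predecessors \<open>h i\<close> compute \<open>k + i\<close>. Hence
  \<open>d\<close>, the value of \<open>g\<close> at \<open>k + 1\<close>, is \<open>h k\<close>
  plus two.\<close>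

lemma is_sum_succ:
  assumes "is_sum d (succ k) (succ k)" "is_natural k"
  shows "\<exists>d'. is_natural d' \<and> d = succ (succ d') \<and> is_sum d' k k"
proof -
  obtain w g where w: "\<And>n. n \<epsilon> w \<longleftrightarrow> is_natural n" and g: "is_function g w w"
    and g0: "maps_to g emp (succ k)"
    and gs: "\<And>i j. i \<epsilon> w \<Longrightarrow> maps_to g i j \<Longrightarrow> maps_to g (succ i) (succ j)"
    and gk: "maps_to g (succ k) d"
    using assms unfolding is_sum_iff by blast
  have gapp: "maps_to g i j \<longleftrightarrow> j = app g i" if "is_natural i" for i j
    using is_function_app(2)[OF g] that w by blast
  have ex: "\<exists>j. is_natural j \<and> app g i = succ j" if "is_natural i" for i
    using that
  proof (induction i rule: natural_induct)
    show "definable (\<lambda>e. \<exists>j. is_natural j \<and> app g (e 0) = succ j)" by (intro definable_intros)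
    show "\<exists>j. is_natural j \<and> app g emp = succ j"
      using g0 gapp[OF is_natural_emp] assms by auto
    show "\<exists>j. is_natural j \<and> app g (succ x) = succ j"
      if "is_natural x" "\<exists>j. is_natural j \<and> app g x = succ j" for x
      using gs[of x "app g x"] that w gapp[OF that(1)] gapp[OF is_natural_succ[OF that(1)]]
        is_natural_succ by metis
  qed
  define h where "h i = iota (\<lambda>j. app g i = succ j)" for i
  have h: "is_natural (h i) \<and> app g i = succ (h i)" if i: "is_natural i" for i
  proof -
    obtain j where j: "is_natural j" "app g i = succ j" using ex[OF i] by blast
    then have "h i = j" unfolding h_def by (intro iota_eq) auto
    then show ?thesis using j by simp
  qed
  have "definable_fun (\<lambda>e. h (e 0))" unfolding h_def by (intro definable_intros)
  from function_ex[OF this, of w w] h w obtain g' where g': "is_function g' w w"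
    "\<And>a u. maps_to g' a u \<longleftrightarrow> a \<epsilon> w \<and> u = h a" by blast
  have "h emp = k"
    using h[OF is_natural_emp] g0 gapp[OF is_natural_emp] by auto
  moreover have hs: "h (succ i) = succ (h i)" if "is_natural i" for i
    using h[OF that] h[OF is_natural_succ[OF that]] gs[of i "app g i"] w that
      gapp[OF that] gapp[OF is_natural_succ[OF that]] by auto
  ultimately have "is_sum (h k) k k"
    unfolding is_sum_iff
    using g' w assms(2) is_natural_emp is_natural_succ
    by (intro exI[of _ w] exI[of _ g']) auto
  moreover have "d = succ (succ (h k))"
    using gk gapp[OF is_natural_succ[OF assms(2)]] h[OF is_natural_succ[OF assms(2)]] hs[OF
        assms(2)]
    by simp
  ultimately show ?thesis using h[OF assms(2)] by blast
qed

end

subsection \<open>Choosing from 7-element sets\<close>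

text \<open>Two different values give disjoint nonempty levels, and the smaller of them fills at
  most half of \<open>S\<close>.\<close>

lemma nonconstant_small_level:
  fixes s :: "'b \<Rightarrow> nat"
  assumes "finite S" "x \<in> S" "y \<in> S" "s x \<noteq> s y"
  shows "\<exists>i \<in> s ` S. 1 \<le> card {v \<in> S. s v = i} \<and> 2 * card {v \<in> S. s v = i} \<le> card S"
proof -
  let ?L = "\<lambda>i. {v \<in> S. s v = i}"
  have "card (?L (s x)) + card (?L (s y)) = card (?L (s x) \<union> ?L (s y))"
    using assms by (intro card_Un_disjoint[symmetric]) auto
  also have "\<dots> \<le> card S" using assms(1) by (intro card_mono) auto
  finally have "2 * card (?L (s x)) \<le> card S \<or> 2 * card (?L (s y)) \<le> card S" by linarith
  moreover have "1 \<le> card (?L (s v))" if "v \<in> S" for v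
    using that assms(1) by (auto simp: Suc_le_eq card_gt_0_iff)
  ultimately show ?thesis using assms(2,3) by blast
qed

lemma sum_card_fibres:
  assumes "finite P" "finite Z" "\<And>p. p \<in> P \<Longrightarrow> h p \<in> Z"
  shows "(\<Sum>x\<in>Z. card {p \<in> P. h p = x}) = card P"
  using sum.group[OF assms(1,2), of h "\<lambda>_. 1::nat"] assms(3) by (simp add: image_subset_iff)

lemma card_1_iff_ex1: "card {x. P x} = 1 \<longleftrightarrow> (\<exists>!x. P x)"
  by (simp only: One_nat_def card_1_singleton_iff) (auto simp: set_eq_iff)

primrec first_unique :: "('b \<Rightarrow> bool) list \<Rightarrow> 'b \<Rightarrow> bool" where
  "first_unique [] x \<longleftrightarrow> False"
| "first_unique (P # Ps) x \<longleftrightarrow> (if \<exists>!x. P x then P x else first_unique Ps x)"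

lemma first_unique_ex1: "P \<in> set Ps \<Longrightarrow> \<exists>!x. P x \<Longrightarrow> \<exists>!x. first_unique Ps x"
proof (induction Ps)
  case (Cons R Ps)
  then show ?case by (cases "\<exists>!x. R x") auto
qed simp

lemma first_uniqueD: "first_unique Ps x \<Longrightarrow> \<exists>P \<in> set Ps. P x"
  by (induction Ps) (auto split: if_splits)

context ZF_model
begin

text \<open>The list is external and finite, so the nested case distinction is still a single
  first-order formula.\<close>

lemma definable_first_unique:
  assumes "\<And>Q. Q \<in> set Qs \<Longrightarrow> definable (\<lambda>e. Q (e 1) (e 0))"
  shows "definable (\<lambda>e. first_unique (map (\<lambda>Q. Q (e 1)) Qs) (e 0))"
  using assms
proof (induction Qs)
  case Nil
  show ?case by (simp add: definable_const)
next
  case (Cons Q Qs)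
  have "definable (\<lambda>e. Q (e 1) (e 0))" using Cons.prems by simp
  moreover from definable_rename[OF this, of "case_nat 0 (\<lambda>i. Suc (Suc i))"]
  have "definable (\<lambda>e. Q (e 2) (e 0))" by (simp add: numeral_2_eq_2)
  ultimately show ?case
    using Cons by (simp only: list.map first_unique.simps if_bool_eq_disj)
      (intro definable_disj definable_conj definable_neg definable_ex1, simp_all add:
          numeral_2_eq_2)
qed

definition cnt :: "nat \<Rightarrow> ('a \<Rightarrow> bool) \<Rightarrow> bool" where
  "cnt i Q \<longleftrightarrow> finite {x. Q x} \<and> card {x. Q x} = i"

text \<open>This recursion replaces the external \<open>card\<close> by nested quantifiers, which
  makes counting up to a fixed standard \<open>i\<close> definable.\<close>

lemma cnt_Suc: "cnt (Suc i) Q \<longleftrightarrow> (\<exists>a. Q a \<and> cnt i (\<lambda>x. Q x \<and> x \<noteq> a))"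
proof -
  have *: "{x. Q x \<and> x \<noteq> a} = {x. Q x} - {a}" for a by auto
  have "finite S \<and> card S = Suc i \<longleftrightarrow> finite (S - {a}) \<and> card (S - {a}) = i" if "a \<in> S" for S and a
      :: 'a
    using that card_Suc_Diff1[of S a] by auto
  from this[of _ "{x. Q x}"] have "cnt (Suc i) Q \<longleftrightarrow> cnt i (\<lambda>x. Q x \<and> x \<noteq> a)" if "Q a" for a
    using that unfolding cnt_def * by simp
  moreover have "\<exists>a. Q a" if "cnt (Suc i) Q"
  proof (rule ccontr)
    assume "\<not> (\<exists>a. Q a)"
    then have "Collect Q = {}" by auto
    with that show False unfolding cnt_def by (simp only: card.empty) simp
  qed
  ultimately show ?thesis by blast
qed

lemma definable_cnt:
  assumes "definable (\<lambda>e. Q (\<lambda>i. e (Suc i)) (e 0))"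
  shows "definable (\<lambda>e. cnt i (Q e))"
  using assms
proof (induction i arbitrary: Q)
  case 0
  have "cnt 0 R \<longleftrightarrow> Collect R = {}" for R
    unfolding cnt_def by (auto simp only: card_eq_0_iff finite.emptyI)
  then have "cnt 0 R \<longleftrightarrow> (\<forall>x. \<not> R x)" for R by simp
  then show ?case using definable_all[OF definable_neg[OF 0]] by simp
next
  case (Suc i)
  have "definable (\<lambda>e. Q (\<lambda>i. e (Suc (Suc i))) (e 0))"
    using definable_rename[OF Suc.prems, of "case_nat 0 (\<lambda>i. Suc (Suc i))"] by simp
  then have "definable (\<lambda>e. cnt i (\<lambda>x. Q (\<lambda>i. e (Suc i)) x \<and> x \<noteq> e 0))"
    by (intro Suc.IH definable_intros)
  then show ?case unfolding cnt_Suc by (intro definable_intros Suc.prems)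
qed

lemma elts_inject: "elts x = elts y \<longleftrightarrow> x = y"
  unfolding elts_def by (auto intro: elts_eqI)

lemma elts_bin_union: "elts (bin_union x y) = elts x \<union> elts y"
  by auto

lemma elts_set_diff: "elts (set_diff x y) = elts x - elts y"
  by auto

lemma elts_upair: "elts (upair a b) = {a, b}"
  by auto

lemma is_subset_elts: "is_subset x y \<longleftrightarrow> elts x \<subseteq> elts y"
  unfolding is_subset_def by auto

end

text \<open>In HOL \<open>card\<close> is 0 on infinite sets, so the lower bound 5 also says that
  \<open>S\<close> is externally finite.\<close>

locale four_selector = ZF_model +
  fixes f y :: 'a
  assumes selects: "is_subset S y \<Longrightarrow> 5 \<le> card (elts S) \<Longrightarrow>
    is_subset (app f S) S \<and> card (elts (app f S)) = 4"
begin

section \<open>The candidates for the chosen element and their definability\<close>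

definition omitted :: "'a \<Rightarrow> 'a" where "omitted S = iota (\<lambda>x. x \<epsilon> S \<and> \<not> x \<epsilon> app f S)"

definition four :: "'a \<Rightarrow> 'a" where "four z = app f z"
definition three :: "'a \<Rightarrow> 'a" where "three z = set_diff z (app f z)"

definition is_four_pair :: "'a \<Rightarrow> 'a \<Rightarrow> bool" where
  "is_four_pair z p \<longleftrightarrow> (\<exists>a b. a \<epsilon> four z \<and> b \<epsilon> four z \<and> a \<noteq> b \<and> p = upair a b)"

text \<open>This is \<open>d x = i\<close> for the count \<open>d\<close> described at the outset,
  as a relation with an external \<open>i\<close>, so that each instance is definable by way of
  \<open>cnt\<close>.\<close>

definition pair_degree :: "nat \<Rightarrow> 'a \<Rightarrow> 'a \<Rightarrow> bool" where
  "pair_degree i z x \<longleftrightarrow> cnt i (\<lambda>p. is_four_pair z p \<and> omitted (bin_union p (three z)) = x)"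

definition remaining_pair :: "'a \<Rightarrow> 'a \<Rightarrow> 'a" where
  "remaining_pair z a = set_diff (set_diff z (upair a a)) (app f (set_diff z (upair a a)))"

text \<open>
  The pair \<open>p\<close> singles out an element of \<open>three z\<close>: the one omitted from \<open>p \<union> three z\<close> if \<open>p\<close> lies
      in
  \<open>four z\<close>, the one outside \<open>p\<close> if \<open>p\<close> lies in \<open>three z\<close>, and the one in \<open>p\<close> if \<open>p\<close> meets both.
\<close>

definition marks :: "'a \<Rightarrow> 'a \<Rightarrow> 'a \<Rightarrow> bool" where
  "marks z p b \<longleftrightarrow> b \<epsilon> three z \<and>
     ((is_subset p (four z) \<and> b = omitted (bin_union p (three z))) \<or>
      (\<not> is_subset p (four z) \<and> (is_subset p (three z) \<longleftrightarrow> \<not> b \<epsilon> p)))"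

definition cand_four :: "nat \<Rightarrow> 'a \<Rightarrow> 'a \<Rightarrow> bool" where
  "cand_four i z x \<longleftrightarrow> x \<epsilon> four z \<and> pair_degree i z x"

definition cand_three :: "nat \<Rightarrow> 'a \<Rightarrow> 'a \<Rightarrow> bool" where
  "cand_three i z x \<longleftrightarrow> x \<epsilon> three z \<and> pair_degree i z x"

text \<open>Intended for the case that the level of degree \<open>i\<close> in \<open>four z\<close>
  is a pair. The conjunct on \<open>z\<close> keeps every witness inside \<open>z\<close>, whatever
  that level looks like.\<close>

definition cand_level :: "nat \<Rightarrow> 'a \<Rightarrow> 'a \<Rightarrow> bool" where
  "cand_level i z x \<longleftrightarrow> x \<epsilon> z \<and> x = omitted (bin_union (coll (cand_four i z)) (three z))"

definition cand_marked :: "nat \<Rightarrow> 'a \<Rightarrow> 'a \<Rightarrow> bool" where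
  "cand_marked i z x \<longleftrightarrow> x \<epsilon> three z \<and> cnt i (\<lambda>a. a \<epsilon> four z \<and> marks z (remaining_pair z a) x)"

text \<open>Indices below 7 suffice: at most six pairs point to an element, and at most four marks
  fall on it.\<close>

definition candidates :: "('a \<Rightarrow> 'a \<Rightarrow> bool) list" where
  "candidates = concat (map (\<lambda>i. [cand_four i, cand_three i, cand_level i, cand_marked i]) [0..<7])"

text \<open>
  No fixed candidate works for all \<open>z\<close>, so the first candidate with a unique witness decides. This
      keeps
  the choice definable.
\<close>

definition choose7 :: "'a \<Rightarrow> 'a" where
  "choose7 z = iota (first_unique (map (\<lambda>Q. Q z) candidates))"

lemma definable_fun_omitted: "definable_fun t \<Longrightarrow> definable_fun (\<lambda>e. omitted (t e))"
  unfolding omitted_def by (intro definable_intros; erule definable_fun_rename)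

lemma definable_fun_four: "definable_fun t \<Longrightarrow> definable_fun (\<lambda>e. four (t e))"
  unfolding four_def by (intro definable_intros)

lemma definable_fun_three: "definable_fun t \<Longrightarrow> definable_fun (\<lambda>e. three (t e))"
  unfolding three_def by (intro definable_intros)

lemma definable_fun_remaining_pair:
  "definable_fun t \<Longrightarrow> definable_fun s \<Longrightarrow> definable_fun (\<lambda>e. remaining_pair (t e) (s e))"
  unfolding remaining_pair_def by (intro definable_intros)

lemma definable_is_four_pair:
  "definable_fun t \<Longrightarrow> definable_fun s \<Longrightarrow> definable (\<lambda>e. is_four_pair (t e) (s e))"
  unfolding is_four_pair_def
  by (intro definable_intros definable_fun_four; erule definable_fun_rename)

lemma definable_pair_degree:
  "definable_fun t \<Longrightarrow> definable_fun s \<Longrightarrow> definable (\<lambda>e. pair_degree i (t e) (s e))"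
  unfolding pair_degree_def
  by (intro definable_cnt definable_intros definable_is_four_pair definable_fun_omitted
      definable_fun_three; erule definable_fun_rename)

lemma definable_marks:
  "definable_fun t \<Longrightarrow> definable_fun s \<Longrightarrow> definable_fun u \<Longrightarrow> definable (\<lambda>e. marks (t e) (s e) (u e))"
  unfolding marks_def
  by (intro definable_intros definable_fun_omitted definable_fun_three definable_fun_four)

lemma definable_cand_four:
  "definable_fun t \<Longrightarrow> definable_fun s \<Longrightarrow> definable (\<lambda>e. cand_four i (t e) (s e))"
  unfolding cand_four_def by (intro definable_intros definable_fun_four definable_pair_degree)

lemma definable_cand_three:
  "definable_fun t \<Longrightarrow> definable_fun s \<Longrightarrow> definable (\<lambda>e. cand_three i (t e) (s e))"
  unfolding cand_three_def by (intro definable_intros definable_fun_three definable_pair_degree)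

lemma definable_cand_level:
  "definable_fun t \<Longrightarrow> definable_fun s \<Longrightarrow> definable (\<lambda>e. cand_level i (t e) (s e))"
proof -
  assume ts: "definable_fun t" "definable_fun s"
  have "definable_fun (\<lambda>e. coll (\<lambda>v. cand_four i (t e) v))"
    by (intro definable_fun_coll definable_cand_four definable_intros definable_fun_rename[OF
        ts(1)])
  then show ?thesis
    unfolding cand_level_def
    by (intro definable_intros definable_fun_omitted definable_fun_three ts)
qed

lemma definable_cand_marked:
  "definable_fun t \<Longrightarrow> definable_fun s \<Longrightarrow> definable (\<lambda>e. cand_marked i (t e) (s e))"
  unfolding cand_marked_def
  by (intro definable_cnt definable_intros definable_marks definable_fun_remaining_pair
      definable_fun_four definable_fun_three; (erule definable_fun_rename)?)

lemma set_candidates: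
  "Q \<in> set candidates \<longleftrightarrow>
     (\<exists>i<7. Q = cand_four i \<or> Q = cand_three i \<or> Q = cand_level i \<or> Q = cand_marked i)"
  unfolding candidates_def by auto

lemma definable_fun_choose7: "definable_fun (\<lambda>e. choose7 (e 0))"
proof -
  have "definable (\<lambda>e. Q (e 1) (e 0))" if "Q \<in> set candidates" for Q
    using that unfolding set_candidates
    by (auto intro!: definable_cand_four definable_cand_three definable_cand_level
        definable_cand_marked definable_fun_var)
  from definable_first_unique[OF this] have "definable (\<lambda>e. first_unique (map (\<lambda>Q. Q (e 1))
      candidates) (e 0))" .
  then show ?thesis unfolding choose7_def by (intro definable_fun_iota) simp
qed

lemma omitted_eq:
  assumes "is_subset S y" "card (elts S) = 5"
  shows "omitted S \<epsilon> S"
proof -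
  have "is_subset (app f S) S" "card (elts (app f S)) = 4" using selects assms by simp_all
  moreover have "finite (elts S)" using assms by (simp add: card_ge_0_finite)
  ultimately have "card (elts S - elts (app f S)) = 1"
    using assms by (subst card_Diff_subset) (auto simp: is_subset_elts intro: finite_subset)
  moreover have "elts S - elts (app f S) = {x. x \<epsilon> S \<and> \<not> x \<epsilon> app f S}" by auto
  ultimately have "\<exists>!x. x \<epsilon> S \<and> \<not> x \<epsilon> app f S"
    unfolding card_1_iff_ex1[symmetric] by simp
  from iotaI[OF this] show ?thesis unfolding omitted_def by simp
qed

section \<open>Counting inside a fixed 7-element set\<close>

context
  fixes z
  assumes z: "is_subset z y" "card (elts z) = 7"
begin

lemma finite_z: "finite (elts z)"
  using z by (simp add: card_ge_0_finite)

lemma four_subset: "elts (four z) \<subseteq> elts z" and card_four: "card (elts (four z)) = 4"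
  using selects z unfolding four_def is_subset_elts by simp_all

lemma elts_three: "elts (three z) = elts z - elts (four z)"
  unfolding three_def four_def by (rule elts_set_diff)

lemma finite_four: "finite (elts (four z))" and finite_three: "finite (elts (three z))"
  using finite_z four_subset elts_three finite_subset by auto

lemma card_three: "card (elts (three z)) = 3"
  unfolding elts_three using z card_four four_subset finite_four by (simp add: card_Diff_subset)

lemma is_four_pair_iff:
  "is_four_pair z p \<longleftrightarrow> elts p \<subseteq> elts (four z) \<and> card (elts p) = 2"
proof
  assume "is_four_pair z p"
  then show "elts p \<subseteq> elts (four z) \<and> card (elts p) = 2"
    unfolding is_four_pair_def by (auto simp: elts_upair)
next
  assume *: "elts p \<subseteq> elts (four z) \<and> card (elts p) = 2"
  then obtain a b where ab: "elts p = {a, b}" "a \<noteq> b" unfolding card_2_iff by blast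
  then have "p = upair a b" unfolding elts_upair[symmetric] elts_inject by simp
  moreover have "a \<epsilon> four z" "b \<epsilon> four z" using * ab by auto
  ultimately show "is_four_pair z p" unfolding is_four_pair_def using ab by blast
qed

text \<open>Every external 2-element subset is the extension of some \<open>upair a b\<close>, so
  \<open>elts\<close> reduces the count to a binomial coefficient.\<close>

lemma card_four_pairs: "card {p. is_four_pair z p} = 6"
proof -
  have "elts ` {p. is_four_pair z p} = {S. S \<subseteq> elts (four z) \<and> card S = 2}"
  proof (intro equalityI subsetI)
    fix S assume "S \<in> {S. S \<subseteq> elts (four z) \<and> card S = 2}"
    moreover from this obtain a b where "S = {a, b}" by (auto simp: card_2_iff)
    then have "S = elts (upair a b)" unfolding elts_upair .
    ultimately show "S \<in> elts ` {p. is_four_pair z p}" unfolding is_four_pair_iff by blast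
  qed (auto simp: is_four_pair_iff)
  moreover have "card {S. S \<subseteq> elts (four z) \<and> card S = 2} = 6"
    unfolding n_subsets[OF finite_four] card_four by (simp add: choose_two)
  moreover have "inj_on elts {p. is_four_pair z p}" by (intro inj_onI) (simp add: elts_inject)
  ultimately show ?thesis using card_image[of elts "{p. is_four_pair z p}"] by simp
qed

lemma finite_four_pairs: "finite {p. is_four_pair z p}"
  using card_four_pairs by (simp add: card_ge_0_finite)

lemma omitted_pair:
  assumes "is_four_pair z p"
  shows "omitted (bin_union p (three z)) \<epsilon> p \<or> omitted (bin_union p (three z)) \<epsilon> three z"
proof -
  have p: "elts p \<subseteq> elts (four z)" "card (elts p) = 2" using assms unfolding is_four_pair_iff by
      auto
  then have "card (elts p \<union> elts (three z)) = 5"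
    using card_three finite_three finite_subset[OF p(1) finite_four] elts_three
    by (subst card_Un_disjoint) auto
  moreover have "is_subset (bin_union p (three z)) y"
    using p(1) four_subset z(1) elts_three unfolding is_subset_elts elts_bin_union by auto
  ultimately show ?thesis using omitted_eq[of "bin_union p (three z)"] by (simp add: elts_bin_union)
qed

text \<open>A nonempty level that fills at most half of three elements is a singleton. The weight
  \<open>s\<close> is kept general because it is used both for degrees and for numbers of
  marks.\<close>

lemma nonconstant_three:
  fixes s :: "'a \<Rightarrow> nat"
  assumes "u \<in> elts (three z)" "v \<in> elts (three z)" "s u \<noteq> s v" "\<And>x. s x \<le> 6"
  shows "\<exists>i<7. \<exists>!x. x \<epsilon> three z \<and> s x = i"
proof -
  obtain i where i: "i \<in> s ` elts (three z)" "1 \<le> card {x \<in> elts (three z). s x = i}"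
    "2 * card {x \<in> elts (three z). s x = i} \<le> card (elts (three z))"
    using nonconstant_small_level[of "elts (three z)" u v s] assms finite_three by blast
  then have "card {x \<in> elts (three z). s x = i} = 1" unfolding card_three by linarith
  moreover have "i < 7" using i(1) le_less_trans[OF assms(4)] by auto
  ultimately show ?thesis unfolding card_1_iff_ex1 mem_elts by blast
qed

definition degree :: "'a \<Rightarrow> nat" where
  "degree x = card {p. is_four_pair z p \<and> omitted (bin_union p (three z)) = x}"

lemma pair_degree_iff: "pair_degree i z x \<longleftrightarrow> degree x = i"
  unfolding pair_degree_def cnt_def degree_def
  using finite_subset[OF _ finite_four_pairs] by auto

lemma degree_le: "degree x \<le> 6"
proof -
  have "degree x \<le> card {p. is_four_pair z p}"
    unfolding degree_def by (rule card_mono[OF finite_four_pairs]) blast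
  then show ?thesis unfolding card_four_pairs .
qed

lemma sum_degree: "(\<Sum>x\<in>elts z. degree x) = 6"
proof -
  have "omitted (bin_union p (three z)) \<in> elts z" if "p \<in> {p. is_four_pair z p}" for p
  proof -
    have p: "is_four_pair z p" using that by simp
    show ?thesis using omitted_pair[OF p]
    proof
      assume "omitted (bin_union p (three z)) \<epsilon> p"
      then have "omitted (bin_union p (three z)) \<in> elts p" by simp
      then show ?thesis using p four_subset unfolding is_four_pair_iff by blast
    next
      assume "omitted (bin_union p (three z)) \<epsilon> three z"
      then have "omitted (bin_union p (three z)) \<in> elts (three z)" by simp
      then show ?thesis unfolding elts_three by blast
    qed
  qed
  from sum_card_fibres[OF finite_four_pairs finite_z this] show ?thesis
    unfolding degree_def card_four_pairs by simp
qed

lemma nonconstant_four: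
  assumes "u \<in> elts (four z)" "v \<in> elts (four z)" "degree u \<noteq> degree v"
  shows "\<exists>Q \<in> set candidates. \<exists>!x. Q z x"
proof -
  obtain i where i: "i \<in> degree ` elts (four z)" "1 \<le> card {x \<in> elts (four z). degree x = i}"
    "2 * card {x \<in> elts (four z). degree x = i} \<le> card (elts (four z))"
    using nonconstant_small_level[of "elts (four z)" u v degree] assms finite_four by blast
  have i7: "i < 7" using i(1) le_less_trans[OF degree_le] by auto
  have L: "{x \<in> elts (four z). degree x = i} = {x. cand_four i z x}"
    unfolding cand_four_def pair_degree_iff by auto
  have "card {x. cand_four i z x} = 1 \<or> card {x. cand_four i z x} = 2"
    using i(2,3) unfolding L card_four by linarith
  then show ?thesis
  proof
    assume "card {x. cand_four i z x} = 1"
    then show ?thesis using i7 unfolding card_1_iff_ex1 by (intro bexI[of _ "cand_four i"])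
        (auto simp: set_candidates)
  next
    assume c: "card {x. cand_four i z x} = 2"
    then obtain a b where "{x. cand_four i z x} = {a, b}" unfolding card_2_iff by blast
    \<comment> \<open>The class of this level is a set because \<open>upair a b\<close> is one, so
      \<open>coll\<close> takes its intended value.\<close>
    then have "x \<epsilon> upair a b \<longleftrightarrow> cand_four i z x" for x unfolding mem_upair by auto
    then have "x \<epsilon> coll (cand_four i z) \<longleftrightarrow> cand_four i z x" for x
      by (intro mem_coll_ex exI[of _ "upair a b"]) simp
    then have e: "elts (coll (cand_four i z)) = {x. cand_four i z x}" unfolding elts_def by simp
    then have "is_four_pair z (coll (cand_four i z))"
      unfolding is_four_pair_iff using c by (auto simp: cand_four_def)
    from omitted_pair[OF this]
    have "omitted (bin_union (coll (cand_four i z)) (three z)) \<in> {x. cand_four i z x} \<union> elts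
        (three z)"
      unfolding e[symmetric] by simp
    then have "omitted (bin_union (coll (cand_four i z)) (three z)) \<epsilon> z"
      using four_subset elts_three by (auto simp: cand_four_def)
    then have "\<exists>!x. cand_level i z x" unfolding cand_level_def by blast
    then show ?thesis using i7 by (intro bexI[of _ "cand_level i"]) (auto simp: set_candidates)
  qed
qed

text \<open>Removing \<open>a\<close> and then four selected elements leaves a pair. The second
  assumption settles a pair inside \<open>four z\<close>; a pair inside \<open>three z\<close>
  leaves out one of the three elements; a mixed pair has exactly one element in
  \<open>three z\<close>.\<close>

lemma marks_ex1:
  assumes "a \<epsilon> four z" and "\<And>p. is_four_pair z p \<Longrightarrow> omitted (bin_union p (three z)) \<epsilon> three z"
  shows "\<exists>!b. marks z (remaining_pair z a) b"
proof -
  define p where "p = remaining_pair z a"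
  have "a \<in> elts z" using assms(1) four_subset by auto
  then have 6: "card (elts (set_diff z (upair a a))) = 6"
    using z finite_z by (simp add: elts_set_diff_single)
  moreover have "is_subset (set_diff z (upair a a)) y"
    using z(1) unfolding is_subset_elts by auto
  ultimately have "is_subset (app f (set_diff z (upair a a))) (set_diff z (upair a a))"
    "card (elts (app f (set_diff z (upair a a)))) = 4"
    using selects by simp_all
  then have "card (elts p) = 2"
    unfolding p_def remaining_pair_def elts_set_diff[of "set_diff z (upair a a)"] is_subset_elts
    using 6 finite_z by (subst card_Diff_subset) (auto intro: finite_subset simp:
        elts_set_diff_single)
  moreover have sub: "elts p \<subseteq> elts z" unfolding p_def remaining_pair_def by auto
  ultimately obtain c d where cd: "elts p = {c, d}" "c \<noteq> d" unfolding card_2_iff by blast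
  have mem_p: "x \<epsilon> p \<longleftrightarrow> x = c \<or> x = d" for x using cd(1) unfolding elts_def by auto
  have mem_three: "x \<epsilon> three z \<longleftrightarrow> x \<epsilon> z \<and> \<not> x \<epsilon> four z" for x
    unfolding three_def four_def by simp
  consider "is_subset p (four z)" | "is_subset p (three z)" "\<not> is_subset p (four z)"
    | "\<not> is_subset p (three z)" "\<not> is_subset p (four z)" by blast
  then have "\<exists>!b. marks z p b"
  proof cases
    case 1
    then have "is_four_pair z p"
      using \<open>card (elts p) = 2\<close> unfolding is_four_pair_iff is_subset_elts by simp
    from assms(2)[OF this] show ?thesis unfolding marks_def using 1 by auto
  next
    case 2
    then have "card (elts (three z) - elts p) = 1"
      using \<open>card (elts p) = 2\<close> card_three finite_three
      by (subst card_Diff_subset) (auto intro: finite_subset simp: is_subset_elts)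
    moreover have "elts (three z) - elts p = {b. marks z p b}" unfolding marks_def using 2 by auto
    ultimately show ?thesis unfolding card_1_iff_ex1[symmetric] by simp
  next
    case 3
    then have "marks z p b \<longleftrightarrow> b \<epsilon> three z \<and> (b = c \<or> b = d)" for b
      unfolding marks_def mem_p by auto
    moreover have "c \<epsilon> z" "d \<epsilon> z" using sub cd by auto
    then have "c \<epsilon> three z \<longleftrightarrow> \<not> d \<epsilon> three z"
      using 3 unfolding is_subset_def mem_p mem_three by auto
    ultimately show ?thesis by (cases "c \<epsilon> three z") auto
  qed
  then show ?thesis unfolding p_def .
qed

text \<open>With constant values \<open>u\<close> and \<open>v\<close> the degree sum reads
  \<open>4 * u + 3 * v = 6\<close>, whose only solution in naturals is \<open>u = 0\<close>,
  \<open>v = 2\<close>.\<close>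

lemma constant_degree:
  assumes "\<And>u v. u \<in> elts (four z) \<Longrightarrow> v \<in> elts (four z) \<Longrightarrow> degree u = degree v"
    and "\<And>u v. u \<in> elts (three z) \<Longrightarrow> v \<in> elts (three z) \<Longrightarrow> degree u = degree v"
    and "x \<in> elts (four z)"
  shows "degree x = 0"
proof -
  obtain w where w: "w \<in> elts (three z)"
    using card_three by (metis card.empty ex_in_conv numeral_eq_iff zero_neq_numeral)
  have "elts z = elts (four z) \<union> elts (three z)" using elts_three four_subset by auto
  then have "6 = (\<Sum>v\<in>elts (four z). degree v) + (\<Sum>v\<in>elts (three z). degree v)"
    unfolding sum_degree[symmetric]
    using sum.union_disjoint[OF finite_four finite_three, of degree] elts_three by auto
  also have "(\<Sum>v\<in>elts (four z). degree v) = (\<Sum>v\<in>elts (four z). degree x)"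
    by (intro sum.cong refl assms(1,3))
  also have "(\<Sum>v\<in>elts (three z). degree v) = (\<Sum>v\<in>elts (three z). degree w)"
    by (intro sum.cong refl assms(2) w)
  finally have "6 = 4 * degree x + 3 * degree w"
    unfolding sum_constant card_four card_three by simp
  then show ?thesis by presburger
qed

lemma ex_candidate: "\<exists>Q \<in> set candidates. \<exists>!x. Q z x"
proof (cases "\<exists>u \<in> elts (four z). \<exists>v \<in> elts (four z). degree u \<noteq> degree v")
  case True
  then show ?thesis using nonconstant_four by blast
next
  case const_four: False
  show ?thesis
  proof (cases "\<exists>u \<in> elts (three z). \<exists>v \<in> elts (three z). degree u \<noteq> degree v")
    case True
    then obtain i where "i < 7" "\<exists>!x. x \<epsilon> three z \<and> degree x = i"
      using nonconstant_three[of _ _ degree] degree_le by blast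
    then have "\<exists>!x. cand_three i z x" unfolding cand_three_def pair_degree_iff by simp
    then show ?thesis using \<open>i < 7\<close> by (intro bexI[of _ "cand_three i"]) (auto simp: set_candidates)
  next
    case False
    \<comment> \<open>A pair pointing into \<open>four z\<close> would give its target a positive
      degree, but the degree vanishes on \<open>four z\<close>.\<close>
    have omitted_three: "omitted (bin_union p (three z)) \<epsilon> three z" if p: "is_four_pair z p" for p
    proof (rule ccontr)
      assume "\<not> omitted (bin_union p (three z)) \<epsilon> three z"
      then have "omitted (bin_union p (three z)) \<in> elts (four z)"
        using omitted_pair[OF p] p unfolding is_four_pair_iff by auto
      then have "degree (omitted (bin_union p (three z))) = 0"
        using constant_degree const_four False by blast
      then show False
        using p finite_subset[OF _ finite_four_pairs] unfolding degree_def
        by (auto simp: card_eq_0_iff)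
    qed
    \<comment> \<open>\<open>b a\<close> is the element of \<open>three z\<close> marked by
      \<open>a\<close>, and \<open>s x\<close> below counts the marks on \<open>x\<close>.\<close>
    define b where "b a = iota (marks z (remaining_pair z a))" for a
    have b: "marks z (remaining_pair z a) x \<longleftrightarrow> x = b a" if "a \<epsilon> four z" for a x
      using marks_ex1[OF that omitted_three] iotaI[OF marks_ex1[OF that omitted_three]]
      unfolding b_def by blast
    define s where "s x = card {a \<in> elts (four z). b a = x}" for x
    have "b a \<in> elts (three z)" if "a \<in> elts (four z)" for a
      using b[of a "b a"] that unfolding marks_def by simp
    then have sum: "(\<Sum>x\<in>elts (three z). s x) = 4"
      unfolding s_def card_four[symmetric] by (intro sum_card_fibres finite_four finite_three)
    obtain w where w: "w \<in> elts (three z)"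
      using card_three by (metis card.empty ex_in_conv numeral_eq_iff zero_neq_numeral)
    \<comment> \<open>Four marks cannot be spread evenly over three elements.\<close>
    have "\<exists>v \<in> elts (three z). s v \<noteq> s w"
    proof (rule ccontr)
      assume "\<not> ?thesis"
      then have "(\<Sum>x\<in>elts (three z). s x) = (\<Sum>x\<in>elts (three z). s w)"
        by (intro sum.cong) auto
      then have "4 = 3 * s w" unfolding sum sum_constant card_three by simp
      then show False by presburger
    qed
    moreover have "s x \<le> 6" for x
    proof -
      have "s x \<le> card (elts (four z))" unfolding s_def by (intro card_mono finite_four) auto
      then show ?thesis unfolding card_four by simp
    qed
    ultimately obtain i where i: "i < 7" "\<exists>!x. x \<epsilon> three z \<and> s x = i"
      using nonconstant_three[of _ w s] w by blast
    have "{a. a \<epsilon> four z \<and> marks z (remaining_pair z a) x} = {a \<in> elts (four z). b a = x}" for x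
      using b by auto
    moreover have "finite {a \<in> elts (four z). b a = x}" for x
      by (rule finite_subset[OF _ finite_four]) blast
    ultimately have "cand_marked i z x \<longleftrightarrow> x \<epsilon> three z \<and> s x = i" for x
      unfolding cand_marked_def cnt_def s_def by (simp only: simp_thms)
    then show ?thesis
      using i by (intro bexI[of _ "cand_marked i"]) (auto simp: set_candidates)
  qed
qed

text \<open>Every candidate confines its witnesses to \<open>z\<close>, so it does not matter which
  one decides.\<close>

lemma choose7_mem: "choose7 z \<epsilon> z"
proof -
  obtain Q where "Q \<in> set candidates" "\<exists>!x. Q z x" using ex_candidate by blast
  then have "\<exists>!x. first_unique (map (\<lambda>Q. Q z) candidates) x"
    by (intro first_unique_ex1[of "Q z"]) auto
  from iotaI[OF this] have "first_unique (map (\<lambda>Q. Q z) candidates) (choose7 z)"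
    unfolding choose7_def .
  from first_uniqueD[OF this] obtain Q where "Q \<in> set candidates" "Q z (choose7 z)" by auto
  then have "choose7 z \<epsilon> z \<or> choose7 z \<epsilon> four z \<or> choose7 z \<epsilon> three z"
    unfolding set_candidates cand_four_def cand_three_def cand_level_def cand_marked_def by auto
  then show ?thesis using four_subset elts_three by auto
qed

end

end

subsection \<open>The induction on the size\<close>

context ZF_model
begin

text \<open>The body of \<open>RC\<close> for one fixed set, because the induction on the size keeps
  the same \<open>y\<close> throughout.\<close>

definition has_choice :: "'a \<Rightarrow> 'a \<Rightarrow> bool" where
  "has_choice y n \<longleftrightarrow> (\<exists>A f. is_subsets_of_size A y n \<and> is_function f A y \<and>
     (\<forall>z u. z \<epsilon> A \<and> maps_to f z u \<longrightarrow> u \<epsilon> z))"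

lemma definable_has_choice:
  "definable_fun t \<Longrightarrow> definable_fun s \<Longrightarrow> definable (\<lambda>e. has_choice (t e) (s e))"
  unfolding has_choice_def by (intro definable_intros; erule definable_fun_rename)

text \<open>With \<open>has_choiceE\<close>, this trades choice functions inside the model for
  definable operations, which can be composed directly.\<close>

lemma has_choiceI:
  assumes C: "definable_fun (\<lambda>e. C (e 0))"
    and mem: "\<And>z. is_subset z y \<Longrightarrow> equinumerous z n \<Longrightarrow> C z \<epsilon> z"
  shows "has_choice y n"
proof -
  obtain P where P: "\<And>z. z \<epsilon> P \<longleftrightarrow> is_subset z y" using powerset by blast
  have "definable (\<lambda>e. equinumerous (e 0) n)" by (intro definable_intros)
  then obtain A where A: "\<And>z. z \<epsilon> A \<longleftrightarrow> z \<epsilon> P \<and> equinumerous z n"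
    using separation_definable[of "\<lambda>z. equinumerous z n" P] by auto
  have "C z \<epsilon> y" if "z \<epsilon> A" for z
    using that mem unfolding A P is_subset_def by blast
  from function_ex[OF C this] obtain f where f: "is_function f A y"
    "\<And>a u. maps_to f a u \<longleftrightarrow> a \<epsilon> A \<and> u = C a" by blast
  show ?thesis
    unfolding has_choice_def
  proof (rule exI[of _ A], rule exI[of _ f], intro conjI allI impI)
    show "is_subsets_of_size A y n" unfolding is_subsets_of_size_def A P by simp
    show "u \<epsilon> z" if "z \<epsilon> A \<and> maps_to f z u" for z u
      using that mem unfolding f(2) A P by blast
  qed (rule f(1))
qed

lemma has_choiceE:
  assumes "has_choice y n"
  obtains C where "definable_fun (\<lambda>e. C (e 0))"
    and "\<And>z. is_subset z y \<Longrightarrow> equinumerous z n \<Longrightarrow> C z \<epsilon> z"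
proof -
  obtain A f where A: "is_subsets_of_size A y n" and f: "is_function f A y"
    "\<And>z u. z \<epsilon> A \<Longrightarrow> maps_to f z u \<Longrightarrow> u \<epsilon> z"
    using assms unfolding has_choice_def by blast
  show thesis
  proof (rule that[of "app f"])
    show "definable_fun (\<lambda>e. app f (e 0))" by (intro definable_intros)
    fix z assume "is_subset z y" "equinumerous z n"
    then have "z \<epsilon> A" using A unfolding is_subsets_of_size_def by simp
    then show "app f z \<epsilon> z" using f(2) is_function_app(2)[OF f(1)] by simp
  qed
qed

text \<open>Here \<open>n\<close> may be nonstandard, but \<open>w\<close> is externally finite, so
  HOL induction removes its elements one by one by means of
  \<open>equinumerous_succ\<close>.\<close>

lemma equinumerous_set_diff:
  assumes "finite (elts w)" "elts w \<subseteq> elts z" "equinumerous z ((succ ^^ card (elts w)) n)"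
  shows "equinumerous (set_diff z w) n"
  using assms
proof (induction "card (elts w)" arbitrary: z w)
  case 0
  then have "elts w = {}" by simp
  then have "\<not> x \<epsilon> w" for x unfolding elts_def by simp
  then have "set_diff z w = z" by (intro elts_eqI) simp
  then show ?case using 0 by simp
next
  case (Suc k)
  then obtain a where a: "a \<epsilon> w" by (metis card.empty ex_in_conv mem_elts nat.distinct(1))
  have c: "card (elts (set_diff w (upair a a))) = k"
    using Suc.hyps(2) Suc.prems(1) a by (simp add: elts_set_diff_single)
  have "a \<epsilon> z" using a Suc.prems(2) by auto
  moreover have "equinumerous z (succ ((succ ^^ k) n))"
    using Suc.prems(3) unfolding Suc.hyps(2)[symmetric] by simp
  ultimately have "equinumerous (set_diff z (upair a a)) ((succ ^^ k) n)"
    using equinumerous_succ by blast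
  then have "equinumerous (set_diff (set_diff z (upair a a)) (set_diff w (upair a a))) n"
    using Suc.prems c by (intro Suc.hyps(1)) (auto simp: elts_set_diff_single)
  moreover have "set_diff (set_diff z (upair a a)) (set_diff w (upair a a)) = set_diff z w"
    using a by (intro elts_eqI) auto
  ultimately show ?case by simp
qed

lemma is_natural_numeral_of: "is_natural (numeral_of k)"
  by (induction k) (auto intro: is_natural_emp is_natural_succ)

lemma mem_numeral_of: "i < k \<Longrightarrow> numeral_of i \<epsilon> numeral_of k"
  by (induction k) (auto simp: less_Suc_eq)

text \<open>Guarantees that the selector applies to sets of size \<open>n + 5\<close>. Induction
  inside the model covers nonstandard \<open>n\<close> as well.\<close>

lemma numeral_of_4_mem_succ4:
  assumes "is_natural n"
  shows "numeral_of 4 \<epsilon> (succ ^^ 5) n"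
  using assms
proof (induction n rule: natural_induct)
  case definable
  have "definable_fun (\<lambda>e. (succ ^^ k) (e 0))" for k
    by (induction k) (simp_all add: definable_fun_var definable_fun_succ)
  then show ?case by (intro definable_intros)
next
  case emp
  show ?case using mem_numeral_of[of 4 5] unfolding numeral_of_def by simp
next
  case (succ x)
  have "(succ ^^ 5) (succ x) = succ ((succ ^^ 5) x)" by (simp add: funpow_swap1)
  then show ?case using succ by simp
qed

lemma nRC_fin_imp_RC:
  assumes "nRC_fin (numeral_of 4)" "is_odd n" "numeral_of 4 \<epsilon> n"
  shows "RC n"
  unfolding RC_def
proof (intro allI impI)
  fix x assume "is_infinite x"
  then obtain y Y B f where y: "is_infinite y" "is_subset y x"
    and Y: "is_finite_subsets_above Y y (numeral_of 4)" and B: "is_subsets_of_size B y (numeral_of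
        4)"
    and f: "is_function f Y B" and sub: "\<And>z u. z \<epsilon> Y \<Longrightarrow> maps_to f z u \<Longrightarrow> is_subset u z"
    using assms(1) unfolding nRC_fin_def by metis
  \<comment> \<open>Even if the size \<open>m\<close> of \<open>z\<close> is nonstandard, the
    selected subset has standard size 4, so \<open>card\<close> describes it.\<close>
  have sel: "is_subset (app f z) z \<and> finite (elts (app f z)) \<and> card (elts (app f z)) = 4"
    if "is_subset z y" "is_natural m" "numeral_of 4 \<epsilon> m" "equinumerous z m" for z m
  proof -
    have z: "z \<epsilon> Y" using Y that unfolding is_finite_subsets_above_def by blast
    have "app f z \<epsilon> B" using is_function_app(1)[OF f z] .
    then have "equinumerous (app f z) (numeral_of 4)" using B unfolding is_subsets_of_size_def by
        blast
    moreover have "is_subset (app f z) z" using sub[OF z] is_function_app(2)[OF f z] by blast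
    ultimately show ?thesis unfolding equinumerous_numeral_of by blast
  qed
  interpret four_selector mem f y
  proof
    fix S assume S: "is_subset S y" "5 \<le> card (elts S)"
    then have "equinumerous S (numeral_of (card (elts S)))"
      unfolding equinumerous_numeral_of by (auto intro: card_ge_0_finite)
    moreover have "numeral_of 4 \<epsilon> numeral_of (card (elts S))" using S by (intro mem_numeral_of) simp
    ultimately show "is_subset (app f S) S \<and> card (elts (app f S)) = 4"
      using sel[OF S(1) is_natural_numeral_of] by blast
  qed
  have one: "has_choice y (succ emp)"
  proof (rule has_choiceI[of "\<lambda>z. iota (\<lambda>x. x \<epsilon> z)"])
    show "definable_fun (\<lambda>e. iota (\<lambda>x. x \<epsilon> e 0))" by (intro definable_intros)
    fix z assume "equinumerous z (succ emp)"
    then have "card {x. x \<epsilon> z} = 1" using equinumerous_numeral_of[of z 1] by (simp add: elts_def)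
    then show "iota (\<lambda>x. x \<epsilon> z) \<epsilon> z" unfolding card_1_iff_ex1 by (rule iotaI)
  qed
  have seven: "has_choice y (numeral_of 7)"
    using definable_fun_choose7 choose7_mem unfolding equinumerous_numeral_of
    by (intro has_choiceI[of choose7]) (auto simp: equinumerous_numeral_of)
  \<comment> \<open>The size is written \<open>succ m\<close> so that the larger sets have at least
    five elements. Removing the four selected ones leaves a set to which \<open>C\<close>
    applies.\<close>
  have step: "has_choice y ((succ ^^ 4) (succ m))" if m: "is_natural m" "has_choice y (succ m)"
      for m
  proof -
    obtain C where C: "definable_fun (\<lambda>e. C (e 0))"
      "\<And>z. is_subset z y \<Longrightarrow> equinumerous z (succ m) \<Longrightarrow> C z \<epsilon> z"
      using has_choiceE[OF m(2)] by blast
    show ?thesis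
    proof (rule has_choiceI[of "\<lambda>z. C (set_diff z (app f z))"])
      show "definable_fun (\<lambda>e. C (set_diff (e 0) (app f (e 0))))"
        by (rule definable_fun_subst1[OF C(1)]) (intro definable_intros)
      fix z assume z: "is_subset z y" "equinumerous z ((succ ^^ 4) (succ m))"
      have "(succ ^^ 4) (succ m) = (succ ^^ 5) m" by (simp add: eval_nat_numeral)
      then have "numeral_of 4 \<epsilon> (succ ^^ 4) (succ m)" using numeral_of_4_mem_succ4[OF m(1)] by simp
      moreover have "is_natural ((succ ^^ k) m)" for k
        by (induction k) (auto intro: m(1) is_natural_succ)
      from this[of 5] have "is_natural ((succ ^^ 4) (succ m))" by (simp add: eval_nat_numeral)
      ultimately have F: "is_subset (app f z) z" "finite (elts (app f z))" "card (elts (app f z))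
          = 4"
        using sel z by blast+
      then have "equinumerous (set_diff z (app f z)) (succ m)"
        using z(2) by (intro equinumerous_set_diff) (auto simp: is_subset_elts)
      moreover have "is_subset (set_diff z (app f z)) y" using z(1) unfolding is_subset_def by simp
      ultimately have "C (set_diff z (app f z)) \<epsilon> set_diff z (app f z)" using C(2) by blast
      then show "C (set_diff z (app f z)) \<epsilon> z" by simp
    qed
  qed
  \<comment> \<open>\<open>\<Psi> k\<close> concerns the size \<open>2 k + 1\<close> and exempts
    size 3. A step by 4 in size is a step by 2 in \<open>k\<close>, so the induction carries two
    consecutive values.\<close>
  define \<Psi> where "\<Psi> k \<longleftrightarrow> (\<forall>d. is_sum d k k \<longrightarrow> k = succ emp \<or> has_choice y (succ d))" for k
  have \<Psi>: "\<Psi> k \<and> \<Psi> (succ k)" if "is_natural k" for k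
    using that
  proof (induction k rule: natural_induct)
    case definable
    show ?case unfolding \<Psi>_def by (intro definable_intros definable_has_choice)
  next
    case emp
    show ?case using is_sum_emp one unfolding \<Psi>_def by auto
  next
    case (succ k)
    have "has_choice y (succ d)" if d: "is_sum d (succ (succ k)) (succ (succ k))" for d
    proof -
      obtain d1 where d1: "d = succ (succ d1)" "is_sum d1 (succ k) (succ k)"
        using is_sum_succ[OF d is_natural_succ[OF succ(1)]] by blast
      obtain d2 where d2: "d1 = succ (succ d2)" "is_sum d2 k k"
        using is_sum_succ[OF d1(2) succ(1)] by blast
      show ?thesis
      proof (cases "k = succ emp")
        \<comment> \<open>The exempted size 3 offers no induction hypothesis for size 7, which is
          supplied by \<open>seven\<close>.\<close>
        case True
        then obtain d3 where d3: "d2 = succ (succ d3)" "is_sum d3 emp emp"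
          using is_sum_succ[OF _ is_natural_emp, of d2] d2(2) by blast
        have "succ d = numeral_of 7"
          unfolding d1(1) d2(1) d3(1) is_sum_emp[OF d3(2)] numeral_of_def
          by (simp add: eval_nat_numeral)
        then show ?thesis using seven by simp
      next
        case False
        then have "has_choice y (succ d2)" using succ(2) d2(2) unfolding \<Psi>_def by blast
        from step[OF is_sum_natural[OF d2(2)] this] show ?thesis
          unfolding d1(1) d2(1) by (simp add: eval_nat_numeral)
      qed
    qed
    then show ?case using succ(2) unfolding \<Psi>_def by blast
  qed
  obtain k d where k: "is_natural k" "is_sum d k k" "n = succ d"
    using assms(2) unfolding is_odd_def is_succ_iff by blast
  \<comment> \<open>Otherwise \<open>n\<close> would be 3, which does not have 4 as an
    element.\<close>
  have "k \<noteq> succ emp"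
  proof
    assume k1: "k = succ emp"
    then obtain d' where d': "d = succ (succ d')" "is_sum d' emp emp"
      using is_sum_succ[OF _ is_natural_emp, of d] k(2) by blast
    have "numeral_of 4 \<epsilon> succ (succ (succ emp))" using assms(3) unfolding k(3) d'(1) is_sum_emp[OF
        d'(2)] .
    then show False by (simp add: eval_nat_numeral)
  qed
  then have "has_choice y n" using \<Psi>[OF k(1)] k(2,3) unfolding \<Psi>_def by blast
  then show "\<exists>y. is_infinite y \<and> is_subset y x \<and>
         (\<exists>A f. is_subsets_of_size A y n \<and> is_function f A y \<and>
            (\<forall>z u. z \<epsilon> A \<and> maps_to f z u \<longrightarrow> u \<epsilon> z))"
    using y unfolding has_choice_def by blast
qed

end

theorem corollary9p3:
  fixes mem :: "'v \<Rightarrow> 'v \<Rightarrow> bool" and four n :: 'v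
  assumes "ZF_model mem"
    and "mem_structure.is_numeral mem 4 four"
    and "mem_structure.nRC_fin mem four"
    and "mem_structure.is_natural mem n"
    and "mem_structure.is_odd mem n"
    and "mem four n"
  shows "mem_structure.RC mem n"
proof -
  interpret ZF_model mem by (rule assms(1))
  have "four = numeral_of 4" using assms(2) unfolding is_numeral_iff .
  then show ?thesis using nRC_fin_imp_RC assms(3,5,6) by simp
qed

end
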